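(* Let $\Bbbk$ be a field of characteristic $p\ge 3$ and let $(A,\cdot,\{-,-\},(-)^{\{p\}})$ be a restricted Poisson algebra over $\Bbbk$. If the module of Kähler differentials $\Omega_{A/\Bbbk}$ is free over $A$, then $(A,\Omega_{A/\Bbbk},(-)^{[p]})$ is a restricted Lie–Rinehart algebra, where the $p$-map of $\Omega_{A/\Bbbk}$ is determined by $$(x\,\mathrm{d}u)^{[p]}=x^p\,\mathrm{d}(u^{\{p\}})+(x\,\mathrm{d}u)^{p-1}(x)\,\mathrm{d}u$$ for all $x\,\mathrm{d}u\in\Omega_{A/\Bbbk}$ ($x,u\in A$).
   Context: All algebras are over $\Bbbk$, of characteristic $p\ge 3$. A Poisson algebra is a commutative associative algebra $A$ with a Lie bracket $\{-,-\}$ satisfying $\{xy,z\}=x\{y,z\}+y\{x,z\}$. A restricted Lie algebra is a Lie algebra $L$ with a map ($p$-map) $x\mapsto x^{[p]}$ such that, with $\mathrm{ad}_x(y)=[x,y]$: (1) $\mathrm{ad}_x^p=\mathrm{ad}_{x^{[p]}}$; (2) $(\lambda x)^{[p]}=\lambda^p x^{[p]}$ for $\lambda\in\Bbbk$; (3) $(x+y)^{[p]}=x^{[p]}+y^{[p]}+\Lambda_p(x,y)$, where $\Lambda_p(x,y)=\sum_{i=1}^{p-1}\frac{s_i(x,y)}{i}$ and $s_i(x,y)$ is the coefficient of $t^{i-1}$ in the formal expression $\mathrm{ad}_{tx+y}^{p-1}(x)$. A restricted Poisson algebra is a Poisson algebra $A$ with a map $(-)^{\{p\}}:A\to A$ such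 that $(A,\{-,-\},(-)^{\{p\}})$ is a restricted Lie algebra and $(x^2)^{\{p\}}=2x^p x^{\{p\}}$ for all $x\in A$. A Lie–Rinehart algebra $(A,L)$ consists of a commutative algebra $A$ and a Lie algebra $L$ that is an $A$-module, with an anchor map $\alpha:L\to\mathrm{Der}_{\Bbbk}(A)$ that is both $A$-linear and a Lie homomorphism, such that $[X,aY]=a[X,Y]+\alpha(X)(a)Y$ for $a\in A$, $X,Y\in L$. One writes $X(a)=\alpha(X)(a)$. It is a restricted Lie–Rinehart algebra $(A,L,(-)^{[p]})$ if (a) $(L,(-)^{[p]})$ is a restricted Lie algebra; (b) the anchor is a restricted Lie homomorphism, i.e. $\alpha(X^{[p]})=\alpha(X)^p$ ($p$-fold composition); (c) $(aX)^{[p]}=a^pX^{[p]}+(aX)^{p-1}(a)X$ for all $a\in A$, $X\in L$, where $(aX)^{p-1}(a)=\alpha(aX)^{p-1}(a)$. For a Poisson algebra $A$, $(A,\Omega_{A/\Bbbk})$ is a Lie–Rinehart algebra with bracket $[x\,\mathrm{d}u,y\,\mathrm{d}v]=x\{u,y\}\,\mathrm{d}v+y\{x,v\}\,\mathrm{d}u+xy\,\mathrm{d}\{u,v\}$ and anchor $\alpha(x\,\mathrm{d}u)(z)=x\{u,z\}$; thus $(x\,\mathrm{d}u)^{p-1}(x)$ means $\alpha(x\,\mathrm{d}u)^{p-1}$ applied to $x$. The $p$-map is determined by the displayed formula in the sense that it is the (unique) $p$-map on the Lie algebra $\Omega_{A/\Bbbk}$ satisfying it on all elements $x\,\mathrm{d}u$.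 *)

theory Defs
  imports "HOL-Computational_Algebra.Polynomial" "HOL-Library.Poly_Mapping"
begin

section \<open>Restricted Lie algebras\<close>

locale lie_algebra = vector_space scale
  for scale :: "'k::field \<Rightarrow> 'l::ab_group_add \<Rightarrow> 'l" +
  fixes bracket :: "'l \<Rightarrow> 'l \<Rightarrow> 'l"
  assumes bracket_add_left: "bracket (x + y) z = bracket x z + bracket y z"
    and bracket_add_right: "bracket x (y + z) = bracket x y + bracket x z"
    and bracket_scale_left: "bracket (scale c x) y = scale c (bracket x y)"
    and bracket_scale_right: "bracket x (scale c y) = scale c (bracket x y)"
    and bracket_self: "bracket x x = 0"
    and jacobi: "bracket x (bracket y z) + bracket y (bracket z x) + bracket z (bracket x y) = 0"

text \<open>
  An element of the Lie algebra \<open>L[t]\<close> is a polynomial with coefficients in the vector space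
  \<open>L\<close>; the next function is the operator \<open>ad\<close> of the element \<open>t x + y\<close> on \<open>L[t]\<close>.
\<close>

definition ad_pencil :: "('l::ab_group_add \<Rightarrow> 'l \<Rightarrow> 'l) \<Rightarrow> 'l \<Rightarrow> 'l \<Rightarrow> 'l poly \<Rightarrow> 'l poly" where
  "ad_pencil bracket x y f = pCons 0 (map_poly (bracket x) f) + map_poly (bracket y) f"

definition jacobson_s ::
    "nat \<Rightarrow> ('l::ab_group_add \<Rightarrow> 'l \<Rightarrow> 'l) \<Rightarrow> nat \<Rightarrow> 'l \<Rightarrow> 'l \<Rightarrow> 'l" where
  "jacobson_s p bracket i x y = poly.coeff ((ad_pencil bracket x y ^^ (p - 1)) [:x:]) (i - 1)"

definition jacobson_Lambda ::
    "nat \<Rightarrow> ('k::field \<Rightarrow> 'l::ab_group_add \<Rightarrow> 'l) \<Rightarrow> ('l \<Rightarrow> 'l \<Rightarrow> 'l) \<Rightarrow> 'l \<Rightarrow> 'l \<Rightarrow> 'l" where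
  "jacobson_Lambda p scale bracket x y =
     (\<Sum>i = 1..p - 1. scale (1 / of_nat i) (jacobson_s p bracket i x y))"

text \<open>In all locales below, \<open>p\<close> is meant to be the characteristic of the ground field.\<close>

locale restricted_lie_algebra = lie_algebra scale bracket
  for p :: nat
    and scale :: "'k::field \<Rightarrow> 'l::ab_group_add \<Rightarrow> 'l"
    and bracket :: "'l \<Rightarrow> 'l \<Rightarrow> 'l" +
  fixes pmap :: "'l \<Rightarrow> 'l"
  assumes ad_pmap: "(bracket x ^^ p) y = bracket (pmap x) y"
    and pmap_scale: "pmap (scale c x) = scale (c ^ p) (pmap x)"
    and pmap_add: "pmap (x + y) = pmap x + pmap y + jacobson_Lambda p scale bracket x y"


section \<open>Restricted Poisson algebras\<close>

locale comm_algebra = vector_space scale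
  for scale :: "'k::field \<Rightarrow> 'a::comm_ring_1 \<Rightarrow> 'a" +
  assumes scale_mult_left: "scale c (x * y) = scale c x * y"

locale poisson_algebra = comm_algebra scale + lie_algebra scale bracket
  for scale :: "'k::field \<Rightarrow> 'a::comm_ring_1 \<Rightarrow> 'a"
    and bracket :: "'a \<Rightarrow> 'a \<Rightarrow> 'a" +
  assumes leibniz: "bracket (x * y) z = x * bracket y z + y * bracket x z"

locale restricted_poisson_algebra =
  poisson_algebra scale bracket + restricted_lie_algebra p scale bracket pmap
  for p :: nat
    and scale :: "'k::field \<Rightarrow> 'a::comm_ring_1 \<Rightarrow> 'a"
    and bracket :: "'a \<Rightarrow> 'a \<Rightarrow> 'a"
    and pmap :: "'a \<Rightarrow> 'a" +
  assumes pmap_square: "pmap (x ^ 2) = 2 * x ^ p * pmap x"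


section \<open>Restricted Lie--Rinehart algebras\<close>

locale derivation = Vector_Spaces.linear scale scale D
  for scale :: "'k::field \<Rightarrow> 'a::comm_ring_1 \<Rightarrow> 'a"
    and D :: "'a \<Rightarrow> 'a" +
  assumes product_rule: "D (a * b) = a * D b + D a * b"

text \<open>
  The \<open>k\<close>-vector space structure of an \<open>A\<close>-module is the one obtained by restriction along
  \<open>k \<rightarrow> A\<close>, \<open>c \<mapsto> c \<cdot> 1\<close>.
\<close>

abbreviation restrict_scalars ::
    "('k \<Rightarrow> 'a::comm_ring_1 \<Rightarrow> 'a) \<Rightarrow> ('a \<Rightarrow> 'l \<Rightarrow> 'l) \<Rightarrow> 'k \<Rightarrow> 'l \<Rightarrow> 'l" where
  "restrict_scalars scale smul \<equiv> \<lambda>c X. smul (scale c 1) X"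

locale lie_rinehart_algebra =
  A: comm_algebra scale + M: module smul + lie_algebra "restrict_scalars scale smul" bracket
  for scale :: "'k::field \<Rightarrow> 'a::comm_ring_1 \<Rightarrow> 'a"
    and smul :: "'a \<Rightarrow> 'l::ab_group_add \<Rightarrow> 'l"
    and bracket :: "'l \<Rightarrow> 'l \<Rightarrow> 'l" +
  fixes anchor :: "'l \<Rightarrow> 'a \<Rightarrow> 'a"
  assumes anchor_derivation: "derivation scale (anchor X)"
    and anchor_add: "anchor (X + Y) b = anchor X b + anchor Y b"
    and anchor_smult: "anchor (smul a X) b = a * anchor X b"
    and anchor_bracket: "anchor (bracket X Y) b = anchor X (anchor Y b) - anchor Y (anchor X b)"
    and bracket_smult: "bracket X (smul a Y) = smul a (bracket X Y) + smul (anchor X a) Y"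

locale restricted_lie_rinehart_algebra =
  lie_rinehart_algebra scale smul bracket anchor +
  restricted_lie_algebra p "restrict_scalars scale smul" bracket pmap
  for p :: nat
    and scale :: "'k::field \<Rightarrow> 'a::comm_ring_1 \<Rightarrow> 'a"
    and smul :: "'a \<Rightarrow> 'l::ab_group_add \<Rightarrow> 'l"
    and bracket :: "'l \<Rightarrow> 'l \<Rightarrow> 'l"
    and anchor :: "'l \<Rightarrow> 'a \<Rightarrow> 'a"
    and pmap :: "'l \<Rightarrow> 'l" +
  assumes anchor_pmap: "anchor (pmap X) b = (anchor X ^^ p) b"
    and pmap_smult: "pmap (smul a X) =
      smul (a ^ p) (pmap X) + smul ((anchor (smul a X) ^^ (p - 1)) a) X"


section \<open>Kaehler differentials\<close>

text \<open>
  The free \<open>A\<close>-module on the set of symbols \<open>du\<close>, \<open>u \<in> A\<close>, is the type \<open>'a \<Rightarrow>\<^sub>0 'a\<close> of finitely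
  supported functions, where \<open>Poly_Mapping.single u x\<close> stands for \<open>x du\<close>.
\<close>

definition symbol_scale :: "'a::comm_ring_1 \<Rightarrow> ('a \<Rightarrow>\<^sub>0 'a) \<Rightarrow> ('a \<Rightarrow>\<^sub>0 'a)" where
  "symbol_scale a f = Poly_Mapping.map (\<lambda>x. a * x) f"

definition kaehler_relations :: "('k \<Rightarrow> 'a \<Rightarrow> 'a) \<Rightarrow> ('a::comm_ring_1 \<Rightarrow>\<^sub>0 'a) set" where
  "kaehler_relations scale =
     {Poly_Mapping.single (u + v) 1 - Poly_Mapping.single u 1 - Poly_Mapping.single v 1 | u v. True}
   \<union> {Poly_Mapping.single (scale c u) 1 - Poly_Mapping.single u (scale c 1) | c u. True}
   \<union> {Poly_Mapping.single (u * v) 1 - Poly_Mapping.single v u - Poly_Mapping.single u v | u v. True}"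

definition symbol_eval ::
    "('a::comm_ring_1 \<Rightarrow> 'o::ab_group_add \<Rightarrow> 'o) \<Rightarrow> ('a \<Rightarrow> 'o) \<Rightarrow> ('a \<Rightarrow>\<^sub>0 'a) \<Rightarrow> 'o" where
  "symbol_eval smul d f =
     (\<Sum>u \<in> Poly_Mapping.keys f. smul (Poly_Mapping.lookup f u) (d u))"

interpretation symbol_module: module symbol_scale
proof
  have lk: "Poly_Mapping.lookup (symbol_scale a f) u = a * Poly_Mapping.lookup f u"
    for a :: 'a and f u
    by (simp add: symbol_scale_def Poly_Mapping.map.rep_eq when_def)
  show "symbol_scale a (f + g) = symbol_scale a f + symbol_scale a g" for a :: 'a and f g
    by (rule poly_mapping_eqI) (simp add: lk lookup_add algebra_simps)
  show "symbol_scale (a + b) f = symbol_scale a f + symbol_scale b f" for a b :: 'a and f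
    by (rule poly_mapping_eqI) (simp add: lk lookup_add algebra_simps)
  show "symbol_scale a (symbol_scale b f) = symbol_scale (a * b) f" for a b :: 'a and f
    by (rule poly_mapping_eqI) (simp add: lk algebra_simps)
  show "symbol_scale 1 f = f" for f :: "'a \<Rightarrow>\<^sub>0 'a"
    by (rule poly_mapping_eqI) (simp add: lk)
qed

text \<open>
  \<open>(\<Omega>, d)\<close> is the module of Kaehler differentials of \<open>A\<close> over \<open>k\<close>: the canonical map from the free
  module on the symbols \<open>du\<close> identifies \<open>\<Omega>\<close> with the quotient by the submodule generated by the
  relations \<open>d(u + v) = du + dv\<close>, \<open>d(c u) = c du\<close>, \<open>d(u v) = u dv + v du\<close>. The quotient depends on
  the term \<open>scale\<close> and so cannot be a type of its own; \<open>\<Omega>\<close> is therefore an arbitrary type carrying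
  this quotient up to the canonical isomorphism.
\<close>

locale kaehler_differentials = A: comm_algebra scale + M: module smul
  for scale :: "'k::field \<Rightarrow> 'a::comm_ring_1 \<Rightarrow> 'a"
    and smul :: "'a \<Rightarrow> 'o::ab_group_add \<Rightarrow> 'o" +
  fixes d :: "'a \<Rightarrow> 'o"
  assumes surj_symbol_eval: "surj (symbol_eval smul d)"
    and symbol_eval_eq_0_iff:
      "symbol_eval smul d f = 0 \<longleftrightarrow> f \<in> symbol_module.span (kaehler_relations scale)"

definition free_module :: "('a::comm_ring_1 \<Rightarrow> 'm::ab_group_add \<Rightarrow> 'm) \<Rightarrow> bool" where
  "free_module smul \<longleftrightarrow>
     module smul \<and> (\<exists>B. \<not> module.dependent smul B \<and> module.span smul B = UNIV)"

text \<open>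
  The elements \<open>x du\<close> generate \<open>\<Omega>\<close> additively, so there is at most one (bi)additive map with the
  given values on them; that there is one is the well-definedness of bracket and anchor.
\<close>

definition kaehler_bracket ::
    "('a::comm_ring_1 \<Rightarrow> 'o::ab_group_add \<Rightarrow> 'o) \<Rightarrow> ('a \<Rightarrow> 'o) \<Rightarrow> ('a \<Rightarrow> 'a \<Rightarrow> 'a) \<Rightarrow> 'o \<Rightarrow> 'o \<Rightarrow> 'o" where
  "kaehler_bracket smul d poisson = (THE b.
     (\<forall>X Y Z. b (X + Y) Z = b X Z + b Y Z) \<and>
     (\<forall>X Y Z. b X (Y + Z) = b X Y + b X Z) \<and>
     (\<forall>x u y v. b (smul x (d u)) (smul y (d v)) =
        smul (x * poisson u y) (d v) + smul (y * poisson x v) (d u)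
        + smul (x * y) (d (poisson u v))))"

definition kaehler_anchor ::
    "('a::comm_ring_1 \<Rightarrow> 'o::ab_group_add \<Rightarrow> 'o) \<Rightarrow> ('a \<Rightarrow> 'o) \<Rightarrow> ('a \<Rightarrow> 'a \<Rightarrow> 'a) \<Rightarrow> 'o \<Rightarrow> 'a \<Rightarrow> 'a" where
  "kaehler_anchor smul d poisson = (THE \<alpha>.
     (\<forall>X Y z. \<alpha> (X + Y) z = \<alpha> X z + \<alpha> Y z) \<and>
     (\<forall>x u z. \<alpha> (smul x (d u)) z = x * poisson u z))"

end

theory Submission
  imports Defs "HOL-Computational_Algebra.Formal_Power_Series"
begin

text \<open>
  The \<open>p\<close>-map on \<open>\<Omega>\<close> is prescribed on the elements \<open>x du\<close>, and the rule
  \<open>(X + Y)\<^sup>[\<^sup>p\<^sup>] = X\<^sup>[\<^sup>p\<^sup>] + Y\<^sup>[\<^sup>p\<^sup>] + \<Lambda>(X, Y)\<close> then forces it on all sums, so at most one \<open>p\<close>-map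
  can have the given values. For its existence, the rule is read as additivity: \<open>\<Lambda>\<close> is a symmetric
  \<open>2\<close>-cocycle (\<open>jacobson_Lambda_cocycle\<close>, \<open>jacobson_Lambda_commute\<close>), hence
  \<open>(X, R) + (Y, S) = (X + Y, R + S + \<Lambda>(X, Y))\<close> is a commutative monoid structure on
  \<open>\<Omega> \<times> \<Omega>\<close>, and the rule says that \<open>X \<mapsto> (X, X\<^sup>[\<^sup>p\<^sup>])\<close> is additive. An additive map out
  of \<open>\<Omega>\<close> exists as soon as its values on the \<open>x du\<close> respect the defining relations
  (\<open>universal_additive_map\<close>); the anchor and the bracket of \<open>\<Omega>\<close> arise in the same way.

  The relations hold for the prescribed values because of two identities for \<open>\<Lambda>\<close> in any
  Lie--Rinehart algebra of odd characteristic \<open>p\<close>. With \<open>N(a, Z) = (aZ)\<^sup>p\<^sup>-\<^sup>1(a) Z\<close>, the correction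
  term in Hochschild's formula, they are (\<open>jacobson_Lambda_smult_coeff\<close>, \<open>jacobson_Lambda_smult\<close>)
  \<open>\<Lambda>(xZ, yZ) = N(x + y, Z) - N(x, Z) - N(y, Z)\<close>, which gives additivity in \<open>x\<close>, and
  \<open>\<Lambda>(aX, aY) = a\<^sup>p \<Lambda>(X, Y) + N(a, X + Y) - N(a, X) - N(a, Y)\<close>, which gives additivity in \<open>u\<close>.
  The product relation is needed only for squares, by polarisation, and there it is the axiom on
  \<open>(x\<^sup>2)\<^sup>{\<^sup>p\<^sup>}\<close>. The remaining axioms of a restricted Lie--Rinehart algebra are additive in \<open>X\<close>, once
  more by these identities, and so need only be checked on \<open>x du\<close>.

  All statements about \<open>\<Lambda>\<close> are proved by calculus, without an enveloping algebra:
  \<open>\<Lambda>(x, y)\<close> is the integral over \<open>0 \<le> t \<le> 1\<close> of \<open>ad\<^sub>w\<^sup>p\<^sup>-\<^sup>1(w')\<close> along the segment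
  \<open>w = tx + y\<close>. The value at \<open>t = 1\<close> of a polynomial of degree at most \<open>p\<close> is determined by its
  derivative together with its constant coefficient and its coefficient of \<open>t\<^sup>p\<close>
  (\<open>Int01_fps_diff\<close>), so to evaluate \<open>\<Lambda>\<close> it is enough to find a
  polynomial primitive of \<open>ad\<^sub>w\<^sup>p\<^sup>-\<^sup>1(w')\<close>. The primitives come from derivations: the binomial
  coefficients of \<open>p - 1\<close> are \<open>\<plusminus>1\<close>, which makes \<open>\<partial>(ad\<^sub>w\<^sup>p\<^sup>-\<^sup>1(w')) = (ad\<^sub>w\<^sup>p\<^sup>-\<^sup>1(\<partial>w))'\<close> for
  commuting derivations (\<open>dd_ad_power_pred_prime\<close>), and \<open>derivation_hochschild_term\<close> expresses
  \<open>ad\<^sub>u\<^sup>p\<^sup>-\<^sup>1(u')\<close> for \<open>u = aZ\<close> through the derivative of \<open>N(a, Z)\<close>.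
\<close>

section \<open>Binomial coefficients in characteristic \<open>p\<close>\<close>

lemma of_nat_prime_binomial_eq_0:
  assumes "prime p" "of_nat p = (0::'a::comm_ring_1)" "0 < j" "j < p"
  shows "of_nat (p choose j) = (0::'a)"
proof -
  have "p dvd (p choose j)"
    using assms by (intro dvd_choose_prime) auto
  then obtain m where "p choose j = p * m" by blast
  then show ?thesis by (simp add: assms(2))
qed

lemma of_nat_prime_pred_binomial:
  assumes "prime p" "of_nat p = (0::'a::comm_ring_1)" "j < p"
  shows "of_nat ((p - 1) choose j) = ((-1) ^ j :: 'a)"
  using assms(3)
proof (induction j)
  case (Suc j)
  have "p choose Suc j = ((p - 1) choose j) + ((p - 1) choose Suc j)"
    using Suc.prems by (cases p) auto
  then have "of_nat ((p - 1) choose j) + of_nat ((p - 1) choose Suc j) = (0::'a)"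
    using of_nat_prime_binomial_eq_0[OF assms(1,2) _ Suc.prems] by (metis of_nat_add zero_less_Suc)
  then show ?case
    using Suc by (simp add: eq_neg_iff_add_eq_0 add.commute)
qed simp

lemma of_nat_mult_eq_0_imp_eq_0:
  fixes x :: "'a::comm_ring_1"
  assumes "prime p" "of_nat p = (0::'a)" "0 < k" "k < p" "of_nat k * x = 0"
  shows "x = 0"
proof -
  have "coprime k p"
    using assms by (metis coprime_commute nat_dvd_not_less prime_imp_coprime)
  then obtain r s where "k * r = p * s + 1"
    using coprime_bezout_strong[of k p] assms(1) by (metis not_prime_1)
  then have "of_nat k * of_nat r = (1::'a)"
    using assms(2) by (metis add_0 mult_zero_left of_nat_1 of_nat_add of_nat_mult)
  then show ?thesis
    using assms(5) by (metis mult.assoc mult.commute mult.right_neutral mult_zero_right)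
qed

text \<open>
  Pascal's rule in the form in which it drives all inductions on Leibniz-type expansions below.
\<close>

lemma (in module) binomial_sum_Suc:
  "(\<Sum>j\<le>Suc n. scale (of_nat (Suc n choose j)) (f j)) =
   (\<Sum>j\<le>n. scale (of_nat (n choose j)) (f j)) + (\<Sum>j\<le>n. scale (of_nat (n choose j)) (f (Suc j)))"
proof -
  have "(\<Sum>j\<le>Suc n. scale (of_nat (Suc n choose j)) (f j)) =
      f 0 + (\<Sum>j\<le>n. scale (of_nat (n choose Suc j)) (f (Suc j)))
        + (\<Sum>j\<le>n. scale (of_nat (n choose j)) (f (Suc j)))"
    by (subst sum.atMost_Suc_shift) (simp add: scale_left_distrib sum.distrib algebra_simps)
  also have "f 0 + (\<Sum>j\<le>n. scale (of_nat (n choose Suc j)) (f (Suc j))) =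
      (\<Sum>j\<le>Suc n. scale (of_nat (n choose j)) (f j))"
    by (subst sum.atMost_Suc_shift) simp
  also have "\<dots> = (\<Sum>j\<le>n. scale (of_nat (n choose j)) (f j))"
    by (simp add: binomial_eq_0)
  finally show ?thesis .
qed


section \<open>Powers of a multiple of a derivation\<close>

text \<open>
  The pair of an operator on a module and the derivation of the coefficients that it follows, like
  \<open>ad\<^sub>X\<close> and the anchor of \<open>X\<close> in a Lie--Rinehart algebra.
\<close>

locale module_derivation = module smul
  for smul :: "'a::comm_ring_1 \<Rightarrow> 'm::ab_group_add \<Rightarrow> 'm" +
  fixes D :: "'a \<Rightarrow> 'a" and \<delta> :: "'m \<Rightarrow> 'm"
  assumes D_add: "D (a + b) = D a + D b"
    and D_mult: "D (a * b) = a * D b + D a * b"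
    and \<delta>_add: "\<delta> (X + Y) = \<delta> X + \<delta> Y"
    and \<delta>_smul: "\<delta> (smul a X) = smul a (\<delta> X) + smul (D a) X"
begin

lemma D_0: "D 0 = 0"
  using D_add[of 0 0] by simp

lemma D_sum: "D (sum f S) = (\<Sum>i\<in>S. D (f i))"
  by (induction S rule: infinite_finite_induct) (simp_all add: D_0 D_add)

lemma \<delta>_0: "\<delta> 0 = 0"
  using \<delta>_add[of 0 0] by simp

lemma \<delta>_sum: "\<delta> (sum f S) = (\<Sum>i\<in>S. \<delta> (f i))"
  by (induction S rule: infinite_finite_induct) (simp_all add: \<delta>_0 \<delta>_add)

lemma D_of_nat: "D (of_nat n) = 0"
proof -
  have "D 1 = 0" using D_mult[of 1 1] by simp
  then show ?thesis by (induction n) (simp_all add: D_0 D_add)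
qed

lemma D_of_nat_mult: "D (of_nat n * a) = of_nat n * D a"
  by (simp add: D_mult D_of_nat)

lemma \<delta>_of_nat_smul: "\<delta> (smul (of_nat n) X) = smul (of_nat n) (\<delta> X)"
  by (simp add: \<delta>_smul D_of_nat)

lemma leibniz_power:
  "(\<delta> ^^ n) (smul a X) = (\<Sum>j\<le>n. smul (of_nat (n choose j)) (smul ((D ^^ (n - j)) a) ((\<delta> ^^ j) X)))"
proof (induction n)
  case (Suc n)
  let ?f = "\<lambda>j. smul ((D ^^ (Suc n - j)) a) ((\<delta> ^^ j) X)"
  have "(\<delta> ^^ Suc n) (smul a X) = (\<Sum>j\<le>n. smul (of_nat (n choose j))
     (smul (D ((D ^^ (n - j)) a)) ((\<delta> ^^ j) X) + smul ((D ^^ (n - j)) a) (\<delta> ((\<delta> ^^ j) X))))"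
    by (simp add: Suc.IH \<delta>_sum \<delta>_smul D_of_nat add.commute del: scale_scale)
  also have "\<dots> = (\<Sum>j\<le>n. smul (of_nat (n choose j)) (?f j)) + (\<Sum>j\<le>n. smul (of_nat (n choose j)) (?f (Suc j)))"
    by (simp add: scale_right_distrib sum.distrib Suc_diff_le)
  finally show ?case
    by (simp only: binomial_sum_Suc)
qed simp

lemma on_coefficients: "module_derivation (*) D D"
  by unfold_locales (simp_all add: D_add D_mult algebra_simps)

end

text \<open>
  The coefficients \<open>c\<^sub>n\<^sub>k\<close> in the normal form \<open>(a \<delta>)\<^sup>n = \<Sum>\<^sub>k c\<^sub>n\<^sub>k \<delta>\<^sup>k\<close>. They are written down by
  recursion since the powers of \<open>\<delta>\<close> need not be linearly independent.
\<close>

fun scaled_power_coeff :: "('a::comm_ring_1 \<Rightarrow> 'a) \<Rightarrow> 'a \<Rightarrow> nat \<Rightarrow> nat \<Rightarrow> 'a" where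
  "scaled_power_coeff D a 0 k = (if k = 0 then 1 else 0)"
| "scaled_power_coeff D a (Suc n) 0 = 0"
| "scaled_power_coeff D a (Suc n) (Suc k) =
     a * (D (scaled_power_coeff D a n (Suc k)) + scaled_power_coeff D a n k)"

context module_derivation
begin

abbreviation "spc \<equiv> scaled_power_coeff D"

lemma spc_eq_0: "n < k \<Longrightarrow> spc a n k = 0"
  by (induction D\<equiv>D a n k rule: scaled_power_coeff.induct) (auto simp: D_0)

lemma spc_diag: "spc a n n = a ^ n"
  by (induction n) (auto simp: D_0 spc_eq_0)

lemma spc_1: "spc a (Suc n) 1 = ((\<lambda>b. a * D b) ^^ n) a"
proof (induction n)
  case (Suc n)
  have "spc a (Suc (Suc n)) 1 = a * D (spc a (Suc n) 1)" by simp
  then show ?case using Suc by simp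
qed (simp add: D_0)

text \<open>
  As \<open>(a \<delta>)\<^sup>n a \<delta> = (a \<delta>)\<^sup>n\<^sup>+\<^sup>1\<close>, removing the last \<open>\<delta>\<close> shifts both indices of the
  coefficients by one.
\<close>

lemma scaled_power_expansion:
  "((\<lambda>X. smul a (\<delta> X)) ^^ n) (smul a X) = (\<Sum>k\<le>n. smul (spc a (Suc n) (Suc k)) ((\<delta> ^^ k) X))"
proof (induction n)
  case 0
  then show ?case by (simp add: D_0)
next
  case (Suc n)
  let ?c = "spc a (Suc n)"
  have "((\<lambda>X. smul a (\<delta> X)) ^^ Suc n) (smul a X) =
      (\<Sum>k\<le>n. smul (a * D (?c (Suc k))) ((\<delta> ^^ k) X)) + (\<Sum>k\<le>n. smul (a * ?c (Suc k)) ((\<delta> ^^ Suc k) X))"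
    by (simp add: Suc.IH \<delta>_sum \<delta>_smul scale_sum_right scale_right_distrib sum.distrib add.commute del: scaled_power_coeff.simps)
  also have "(\<Sum>k\<le>n. smul (a * D (?c (Suc k))) ((\<delta> ^^ k) X)) =
     (\<Sum>k\<le>Suc n. smul (a * D (?c (Suc k))) ((\<delta> ^^ k) X))"
    by (simp add: spc_eq_0 D_0 del: scaled_power_coeff.simps)
  also have "(\<Sum>k\<le>n. smul (a * ?c (Suc k)) ((\<delta> ^^ Suc k) X)) = (\<Sum>k\<le>Suc n. smul (a * ?c k) ((\<delta> ^^ k) X))"
    by (simp only: sum.atMost_Suc_shift[of _ n]) simp
  also have "(\<Sum>k\<le>Suc n. smul (a * D (?c (Suc k))) ((\<delta> ^^ k) X)) + (\<Sum>k\<le>Suc n. smul (a * ?c k) ((\<delta> ^^ k) X))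
      = (\<Sum>k\<le>Suc n. smul (spc a (Suc (Suc n)) (Suc k)) ((\<delta> ^^ k) X))"
    by (simp only: sum.distrib[symmetric] scale_left_distrib[symmetric] distrib_left[symmetric] scaled_power_coeff.simps(3))
  finally show ?case .
qed

text \<open>
  In the universal case \<open>a \<delta>\<close> is a primitive element for the coproduct of differential operators, so
  that \<open>\<Delta>((a \<delta>)\<^sup>n) = \<Sum>\<^sub>m (n choose m) (a \<delta>)\<^sup>m \<otimes> (a \<delta>)\<^sup>n\<^sup>-\<^sup>m\<close>. The lemma compares the coefficients of
  \<open>\<delta> \<otimes> \<delta>\<^sup>k\<close>.
\<close>

lemma spc_coproduct:
  "of_nat (Suc k) * spc a n (Suc k) = (\<Sum>m\<le>n. of_nat (n choose m) * (spc a m 1 * spc a (n - m) k))"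
proof (induction n arbitrary: k)
  case 0
  then show ?case by simp
next
  case (Suc n)
  let ?S = "\<lambda>f. \<Sum>m\<le>n. of_nat (n choose m) * f m"
  have R: "module ((*) :: 'a \<Rightarrow> 'a \<Rightarrow> 'a)" by unfold_locales (simp_all add: algebra_simps)
  let ?prev = "\<lambda>m. if k = 0 then 0 else spc a m (k - 1)"
  have s1: "spc a (Suc m) 1 = a * D (spc a m 1) + (if m = 0 then a else 0)" for m
    by (cases m) (simp_all add: D_0)
  have s2: "spc a (Suc m) k = a * D (spc a m k) + a * ?prev m" for m
  proof (cases k)
    case 0
    have "D (spc a m 0) = 0" using D_of_nat[of 1] by (cases m) (simp_all add: D_0)
    then show ?thesis using 0 by simp
  qed (simp add: algebra_simps)
  have "(\<Sum>m\<le>Suc n. of_nat (Suc n choose m) * (spc a m 1 * spc a (Suc n - m) k)) =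
      ?S (\<lambda>m. spc a m 1 * spc a (Suc (n - m)) k) + ?S (\<lambda>m. spc a (Suc m) 1 * spc a (n - m) k)"
    by (simp only: module.binomial_sum_Suc[OF R]) (simp add: Suc_diff_le)
  also have "\<dots> = ?S (\<lambda>m. a * D (spc a m 1 * spc a (n - m) k)) + a * ?S (\<lambda>m. spc a m 1 * ?prev (n - m))
      + ?S (\<lambda>m. if m = 0 then a * spc a n k else 0)"
  proof -
    have "of_nat (n choose m) * (spc a m 1 * spc a (Suc (n - m)) k) + of_nat (n choose m) * (spc a (Suc m) 1 * spc a (n - m) k)
      = of_nat (n choose m) * (a * D (spc a m 1 * spc a (n - m) k))
        + a * (of_nat (n choose m) * (spc a m 1 * ?prev (n - m)))
        + of_nat (n choose m) * (if m = 0 then a * spc a n k else 0)" for m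
    proof -
      have "C * (x * (a * y' + a * q)) + C * ((a * x' + e) * y)
          = C * (a * (x * y' + x' * y)) + a * (C * (x * q)) + C * (e * y)" for C x y x' y' q e :: 'a
        by (simp add: algebra_simps)
      from this[of "of_nat (n choose m)" "spc a m 1" "D (spc a (n - m) k)" "?prev (n - m)"
          "D (spc a m 1)" "if m = 0 then a else 0" "spc a (n - m) k"]
      show ?thesis unfolding s1 s2 D_mult by (cases "m = 0") (simp_all only: if_True if_False simp_thms mult_zero_left mult_zero_right diff_zero)
    qed
    then have "(\<Sum>m\<le>n. of_nat (n choose m) * (spc a m 1 * spc a (Suc (n - m)) k) + of_nat (n choose m) * (spc a (Suc m) 1 * spc a (n - m) k))
      = (\<Sum>m\<le>n. of_nat (n choose m) * (a * D (spc a m 1 * spc a (n - m) k))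
        + a * (of_nat (n choose m) * (spc a m 1 * ?prev (n - m)))
        + of_nat (n choose m) * (if m = 0 then a * spc a n k else 0))"
      by (simp only:)
    then show ?thesis
      by (simp only: sum.distrib sum_distrib_left[symmetric])
  qed
  also have "?S (\<lambda>m. if m = 0 then a * spc a n k else 0) = a * spc a n k"
    by (simp add: if_distrib[of "(*) _"] cong: if_cong)
  also have "?S (\<lambda>m. a * D (spc a m 1 * spc a (n - m) k)) = a * D (of_nat (Suc k) * spc a n (Suc k))"
    by (subst Suc.IH) (simp add: D_sum D_of_nat_mult sum_distrib_left algebra_simps)
  also have "?S (\<lambda>m. spc a m 1 * ?prev (n - m)) = of_nat k * spc a n k"
    using Suc.IH[of "k - 1"] by (cases k) (simp_all del: of_nat_Suc)
  finally show ?case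
    by (simp add: D_of_nat_mult algebra_simps D_add)
qed

text \<open>
  For \<open>n = p\<close> the mixed terms of the coproduct formula vanish: \<open>(a \<delta>)\<^sup>p\<close> is again a derivation,
  and only the powers \<open>1\<close> and \<open>p\<close> of \<open>\<delta>\<close> survive in its normal form.
\<close>

lemma spc_prime_eq_0:
  assumes "prime p" "of_nat p = (0::'a)" "1 < k" "k < p"
  shows "spc a p k = 0"
proof -
  obtain i where k: "k = Suc i" and i: "0 < i" using assms(3) by (cases k) auto
  have "of_nat (p choose m) * (spc a m 1 * spc a (p - m) i) = 0" if "m \<le> p" for m
  proof (cases "m = 0 \<or> m = p")
    case False
    then show ?thesis using of_nat_prime_binomial_eq_0[OF assms(1,2)] that by simp
  qed (use i in auto)
  then have "of_nat k * spc a p k = 0"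
    unfolding k spc_coproduct by simp
  then show ?thesis
    using of_nat_mult_eq_0_imp_eq_0[OF assms(1,2), of k] assms(3,4) by simp
qed

text \<open>
  Hochschild's formula \<open>(a \<delta>)\<^sup>p = a\<^sup>p \<delta>\<^sup>p + (a D)\<^sup>p\<^sup>-\<^sup>1(a) \<delta>\<close> with the last \<open>\<delta>\<close> removed from every term.
  In this form it can be applied to vectors that are not in the image of \<open>\<delta>\<close>.
\<close>

lemma hochschild:
  assumes "prime p" "of_nat p = (0::'a)"
  shows "((\<lambda>X. smul a (\<delta> X)) ^^ (p - 1)) (smul a X) =
    smul (((\<lambda>b. a * D b) ^^ (p - 1)) a) X + smul (a ^ p) ((\<delta> ^^ (p - 1)) X)"
proof -
  have p: "p \<ge> 2" "Suc (p - 1) = p" using prime_ge_2_nat[OF assms(1)] by auto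
  have "((\<lambda>X. smul a (\<delta> X)) ^^ (p - 1)) (smul a X) = (\<Sum>k\<le>p - 1. smul (spc a p (Suc k)) ((\<delta> ^^ k) X))"
    using scaled_power_expansion[where n = "p - 1"] p by (metis)
  also have "\<dots> = (\<Sum>k\<in>{0, p - 1}. smul (spc a p (Suc k)) ((\<delta> ^^ k) X))"
  proof (rule sum.mono_neutral_right)
    show "\<forall>k\<in>{..p - 1} - {0, p - 1}. smul (spc a p (Suc k)) ((\<delta> ^^ k) X) = 0"
    proof
      fix k assume "k \<in> {..p - 1} - {0, p - 1}"
      then have "1 < Suc k" "Suc k < p" by auto
      then have "spc a p (Suc k) = 0" by (rule spc_prime_eq_0[OF assms])
      then show "smul (spc a p (Suc k)) ((\<delta> ^^ k) X) = 0" by (simp only: scale_zero_left)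
    qed
  qed (use p in auto)
  also have "\<dots> = smul (spc a p 1) X + smul (spc a p p) ((\<delta> ^^ (p - 1)) X)"
    using p by simp
  finally show ?thesis
    using spc_1[of a "p - 1"] p by (simp add: spc_diag)
qed

end


section \<open>Representations of Lie algebras\<close>

lemma (in lie_algebra) bracket_antisym: "bracket y x = - bracket x y"
proof -
  have "bracket (x + y) (x + y) = bracket x x + bracket y x + (bracket x y + bracket y y)"
    by (simp only: bracket_add_left bracket_add_right)
  then have "bracket x y + bracket y x = 0"
    by (simp add: bracket_self add.commute)
  then show ?thesis by (simp add: eq_neg_iff_add_eq_0 add.commute)
qed

locale lie_representation = lie_algebra scale bracket + V: vector_space scaleV
  for scale :: "'k::field \<Rightarrow> 'l::ab_group_add \<Rightarrow> 'l"
    and bracket :: "'l \<Rightarrow> 'l \<Rightarrow> 'l"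
    and scaleV :: "'k \<Rightarrow> 'v::ab_group_add \<Rightarrow> 'v" +
  fixes rho :: "'l \<Rightarrow> 'v \<Rightarrow> 'v"
  assumes rho_add_left: "rho (x + y) v = rho x v + rho y v"
    and rho_add_right: "rho x (v + w) = rho x v + rho x w"
    and rho_scale_left: "rho (scale c x) v = scaleV c (rho x v)"
    and rho_scale_right: "rho x (scaleV c v) = scaleV c (rho x v)"
    and rho_bracket: "rho (bracket x y) v = rho x (rho y v) - rho y (rho x v)"
begin

lemma rho_0_left [simp]: "rho 0 v = 0"
  using rho_add_left[of 0 0] by simp

lemma rho_0_right [simp]: "rho x 0 = 0"
  using rho_add_right[of x 0 0] by simp

lemma rho_sum_right: "rho x (sum f S) = (\<Sum>i\<in>S. rho x (f i))"
  by (induction S rule: infinite_finite_induct) (simp_all add: rho_add_right)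

lemma rho_minus_left: "rho (- x) v = - rho x v"
  using rho_add_left[of x "-x" v] by (simp add: eq_neg_iff_add_eq_0 add.commute)

lemma rho_minus_right: "rho x (- v) = - rho x v"
  using rho_add_right[of x v "-v"] by (simp add: eq_neg_iff_add_eq_0 add.commute)

text \<open>
  The binomial expansion of \<open>(L\<^sub>x - R\<^sub>x)\<^sup>n(y)\<close>, where \<open>L\<^sub>x\<close> and \<open>R\<^sub>x\<close> are the commuting left and right
  multiplications by \<open>x\<close> on operators.
\<close>

lemma rho_ad_power:
  "rho ((bracket x ^^ n) y) v = (\<Sum>j\<le>n. scaleV (of_nat (n choose j))
     (scaleV ((-1) ^ j) ((rho x ^^ (n - j)) (rho y ((rho x ^^ j) v)))))"
proof (induction n arbitrary: v)
  case (Suc n)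
  let ?F = "\<lambda>j. scaleV ((-1) ^ j) ((rho x ^^ (Suc n - j)) (rho y ((rho x ^^ j) v)))"
  have "rho ((bracket x ^^ Suc n) y) v =
    rho x (rho ((bracket x ^^ n) y) v) + - rho ((bracket x ^^ n) y) (rho x v)"
    by (simp add: rho_bracket)
  also have "rho x (rho ((bracket x ^^ n) y) v) = (\<Sum>j\<le>n. scaleV (of_nat (n choose j)) (?F j))"
    by (simp add: Suc.IH rho_sum_right rho_scale_right Suc_diff_le)
  also have "- rho ((bracket x ^^ n) y) (rho x v) = (\<Sum>j\<le>n. scaleV (of_nat (n choose j)) (?F (Suc j)))"
    by (simp add: Suc.IH sum_negf[symmetric] funpow_swap1)
  finally show ?case
    by (simp only: V.binomial_sum_Suc diff_conv_add_uminus)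
qed simp

text \<open>
  This sum is what a derivation produces when it passes through \<open>x\<^sup>n\<close> inside iterated commutators.
  In characteristic \<open>p\<close> all coefficients are \<open>-1\<close> for \<open>n = p - 1\<close>, and only the last term survives
  for \<open>n = p\<close>.
\<close>

lemma sum_rho_ad_power:
  "(\<Sum>i<n. (rho x ^^ i) (rho ((bracket x ^^ (n - 1 - i)) y) v)) =
   (\<Sum>j<n. scaleV (of_nat (n choose Suc j))
     (scaleV ((-1) ^ j) ((rho x ^^ (n - 1 - j)) (rho y ((rho x ^^ j) v)))))"
proof (induction n)
  case (Suc n)
  let ?F = "\<lambda>j. scaleV ((-1) ^ j) ((rho x ^^ (n - j)) (rho y ((rho x ^^ j) v)))"
  have "(\<Sum>i<Suc n. (rho x ^^ i) (rho ((bracket x ^^ (Suc n - 1 - i)) y) v)) =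
      rho ((bracket x ^^ n) y) v + rho x (\<Sum>i<n. (rho x ^^ i) (rho ((bracket x ^^ (n - 1 - i)) y) v))"
    by (subst sum.lessThan_Suc_shift) (simp add: rho_sum_right)
  also have "rho x (\<Sum>i<n. (rho x ^^ i) (rho ((bracket x ^^ (n - 1 - i)) y) v)) =
      (\<Sum>j<n. scaleV (of_nat (n choose Suc j)) (?F j))"
    unfolding Suc.IH rho_sum_right rho_scale_right
  proof (rule sum.cong)
    fix j assume "j \<in> {..<n}"
    then have "n - j = Suc (n - 1 - j)" by auto
    then show "scaleV (of_nat (n choose Suc j)) (scaleV ((-1) ^ j) (rho x ((rho x ^^ (n - 1 - j)) (rho y ((rho x ^^ j) v)))))
      = scaleV (of_nat (n choose Suc j)) (?F j)" by simp
  qed simp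
  also have "\<dots> = (\<Sum>j\<le>n. scaleV (of_nat (n choose Suc j)) (?F j))"
    by (simp add: lessThan_Suc_atMost[symmetric] binomial_eq_0)
  also have "rho ((bracket x ^^ n) y) v = (\<Sum>j\<le>n. scaleV (of_nat (n choose j)) (?F j))"
    by (rule rho_ad_power)
  finally show ?case
    by (simp only: sum.distrib[symmetric] V.scale_left_distrib[symmetric] of_nat_add[symmetric]
        binomial_Suc_Suc[symmetric] lessThan_Suc_atMost diff_Suc_1 diff_zero)
qed simp

lemma sum_rho_ad_power_pred_prime:
  assumes "prime p" "of_nat p = (0::'k)"
  shows "(\<Sum>i<p - 1. (rho x ^^ i) (rho ((bracket x ^^ (p - 1 - 1 - i)) y) v)) =
    - (\<Sum>j<p - 1. (rho x ^^ (p - 1 - 1 - j)) (rho y ((rho x ^^ j) v)))"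
  unfolding sum_rho_ad_power sum_negf[symmetric]
proof (rule sum.cong)
  fix j assume "j \<in> {..<p - 1}"
  then have "of_nat ((p - 1) choose Suc j) * (-1) ^ j = (- 1 :: 'k)"
    by (simp only: of_nat_prime_pred_binomial[OF assms, of "Suc j"] lessThan_iff less_diff_conv)
       (simp flip: power_add)
  then show "scaleV (of_nat ((p - 1) choose Suc j))
      (scaleV ((-1) ^ j) ((rho x ^^ (p - 1 - 1 - j)) (rho y ((rho x ^^ j) v)))) =
    - ((rho x ^^ (p - 1 - 1 - j)) (rho y ((rho x ^^ j) v)))"
    by simp
qed simp

lemma sum_rho_ad_power_prime:
  assumes "prime p" "of_nat p = (0::'k)" "odd p"
  shows "(\<Sum>i<p. (rho x ^^ i) (rho ((bracket x ^^ (p - 1 - i)) y) v)) = rho y ((rho x ^^ (p - 1)) v)"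
proof -
  have p: "p \<noteq> 0" using assms(1) by auto
  have "(\<Sum>i<p. (rho x ^^ i) (rho ((bracket x ^^ (p - 1 - i)) y) v)) =
    (\<Sum>j\<in>{p - 1}. scaleV (of_nat (p choose Suc j))
     (scaleV ((-1) ^ j) ((rho x ^^ (p - 1 - j)) (rho y ((rho x ^^ j) v)))))"
    unfolding sum_rho_ad_power
  proof (rule sum.mono_neutral_right)
    have "of_nat (p choose Suc j) = (0::'k)" if "j < p" "j \<noteq> p - 1" for j
      using that by (intro of_nat_prime_binomial_eq_0[OF assms(1,2)]) auto
    then show "\<forall>j\<in>{..<p} - {p - 1}. scaleV (of_nat (p choose Suc j))
       (scaleV ((-1) ^ j) ((rho x ^^ (p - 1 - j)) (rho y ((rho x ^^ j) v)))) = 0"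
      by (simp del: V.scale_scale)
  qed (use p in auto)
  then show ?thesis using p assms(3) by simp
qed

end

lemma (in lie_algebra) adjoint_representation: "lie_representation scale bracket scale bracket"
proof
  fix x y v
  have "bracket (bracket x y) v = - bracket v (bracket x y)" by (rule bracket_antisym)
  also have "\<dots> = bracket x (bracket y v) + bracket y (bracket v x)"
    using jacobi[of x y v] by (simp add: eq_neg_iff_add_eq_0 add.commute add.left_commute neg_eq_iff_add_eq_0)
  also have "bracket y (bracket v x) = - bracket y (bracket x v)"
  proof -
    have "bracket y (bracket v x) + bracket y (bracket x v) = bracket y (bracket v x + bracket x v)"
      by (simp only: bracket_add_right)
    also have "bracket v x + bracket x v = 0" using bracket_antisym[of v x] by simp
    also have "bracket y 0 = 0" using bracket_add_right[of y 0 0] by simp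
    finally show ?thesis by (simp add: eq_neg_iff_add_eq_0)
  qed
  finally show "bracket (bracket x y) v = bracket x (bracket y v) - bracket y (bracket x v)" by simp
qed (simp_all add: bracket_add_left bracket_add_right bracket_scale_left bracket_scale_right)

text \<open>
  A \<open>1\<close>-cocycle of a Lie algebra with values in a representation. The three uses below are the
  derivations of the Lie algebra, such as \<open>d/dt\<close> on \<open>L[[t]]\<close>, their coefficientwise extensions, and
  the inner cocycles \<open>x \<mapsto> \<rho>(x) v\<close>.
\<close>

locale crossed_homomorphism = lie_representation +
  fixes dd :: "'b \<Rightarrow> 'c"
  assumes dd_add: "dd (x + y) = dd x + dd y"
    and dd_scale: "dd (scale c x) = scaleV c (dd x)"
    and dd_bracket: "dd (bracket x y) = rho x (dd y) - rho y (dd x)"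
begin

lemma dd_ad_power:
  "dd ((bracket x ^^ n) y) =
    (rho x ^^ n) (dd y) - (\<Sum>i<n. (rho x ^^ i) (rho ((bracket x ^^ (n - 1 - i)) y) (dd x)))"
proof (induction n)
  case (Suc n)
  have "dd ((bracket x ^^ Suc n) y) = rho x (dd ((bracket x ^^ n) y)) - rho ((bracket x ^^ n) y) (dd x)"
    by (simp add: dd_bracket)
  also have "rho x (dd ((bracket x ^^ n) y)) = (rho x ^^ Suc n) (dd y)
      - (\<Sum>i<n. (rho x ^^ Suc i) (rho ((bracket x ^^ (n - 1 - i)) y) (dd x)))"
    unfolding Suc.IH diff_conv_add_uminus rho_add_right rho_minus_right rho_sum_right by simp
  finally show ?case
    by (subst sum.lessThan_Suc_shift) (simp add: algebra_simps)
qed simp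

text \<open>
  The \<open>1\<close>-form \<open>v \<mapsto> ad\<^sub>x\<^sup>p\<^sup>-\<^sup>1(v)\<close> on the Lie algebra is closed: if \<open>x\<close> moves with velocity \<open>y\<close>, the
  right-hand side is exactly the velocity of \<open>\<rho>(x)\<^sup>p\<^sup>-\<^sup>1(\<partial>x)\<close>.
\<close>

lemma dd_ad_power_pred_prime:
  assumes "prime p" "of_nat p = (0::'a)"
  shows "dd ((bracket x ^^ (p - 1)) y) = (rho x ^^ (p - 1)) (dd y)
    + (\<Sum>j<p - 1. (rho x ^^ (p - 1 - 1 - j)) (rho y ((rho x ^^ j) (dd x))))"
  unfolding dd_ad_power sum_rho_ad_power_pred_prime[OF assms] by simp

end

lemma (in lie_representation) inner_crossed_homomorphism:
  "crossed_homomorphism scale bracket scaleV rho (\<lambda>x. rho x v)"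
  by unfold_locales (simp_all add: rho_add_left rho_scale_left rho_bracket)


section \<open>Power series with coefficients in a module\<close>

unbundle fps_syntax

locale biadditive =
  fixes B :: "'a::ab_group_add \<Rightarrow> 'b::ab_group_add \<Rightarrow> 'c::ab_group_add"
  assumes add_left: "B (x + y) u = B x u + B y u"
    and add_right: "B x (u + v) = B x u + B x v"
begin

lemma zero_left [simp]: "B 0 y = 0"
  using add_left[of 0 0 y] by simp

lemma zero_right [simp]: "B x 0 = 0"
  using add_right[of x 0 0] by simp

lemma sum_left: "B (sum f S) y = (\<Sum>i\<in>S. B (f i) y)"
  by (induction S rule: infinite_finite_induct) (simp_all add: add_left)

lemma sum_right: "B x (sum f S) = (\<Sum>i\<in>S. B x (f i))"
  by (induction S rule: infinite_finite_induct) (simp_all add: add_right)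

end

text \<open>
  The Cauchy product of power series that extends a biadditive map of coefficients. Every structure
  map (bracket, scalar multiplication, anchor) is extended to series by this one construction, so an
  identity between trilinear expressions passes to series by comparing sums over \<open>i + j + k = n\<close>.
\<close>

definition conv :: "('a \<Rightarrow> 'b \<Rightarrow> 'c::comm_monoid_add) \<Rightarrow> 'a fps \<Rightarrow> 'b fps \<Rightarrow> 'c fps" where
  "conv B f g = Abs_fps (\<lambda>n. \<Sum>i=0..n. B (f $ i) (g $ (n - i)))"

definition fps_scale :: "('k \<Rightarrow> 'v \<Rightarrow> 'v) \<Rightarrow> 'k \<Rightarrow> 'v fps \<Rightarrow> 'v fps" where
  "fps_scale s c f = Abs_fps (\<lambda>n. s c (f $ n))"

text \<open>
  The formal derivative, with the integer multiples taken by way of the ground field.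
\<close>

definition fps_diff :: "('k::semiring_1 \<Rightarrow> 'v \<Rightarrow> 'v) \<Rightarrow> 'v fps \<Rightarrow> 'v fps" where
  "fps_diff s f = Abs_fps (\<lambda>n. s (of_nat (Suc n)) (f $ Suc n))"

lemma conv_nth: "conv B f g $ n = (\<Sum>i=0..n. B (f $ i) (g $ (n - i)))"
  by (simp add: conv_def)

lemma fps_scale_nth [simp]: "fps_scale s c f $ n = s c (f $ n)"
  by (simp add: fps_scale_def)

lemma fps_diff_nth: "fps_diff s f $ n = s (of_nat (Suc n)) (f $ Suc n)"
  by (simp add: fps_diff_def)

lemma conv_mult: "conv (*) = (*)"
  by (intro ext fps_ext) (simp add: conv_nth fps_mult_nth)

lemma conv_flip: "conv B f g = conv (\<lambda>y x. B x y) g f"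
proof (rule fps_ext)
  fix n
  show "conv B f g $ n = conv (\<lambda>y x. B x y) g f $ n"
    unfolding conv_nth by (rule sum.reindex_bij_witness[of _ "\<lambda>i. n - i" "\<lambda>i. n - i"]) auto
qed

lemma fps_diff_add:
  assumes "vector_space s"
  shows "fps_diff s (f + g) = fps_diff s f + fps_diff s g"
proof -
  interpret vector_space s by fact
  show ?thesis by (rule fps_ext) (simp add: fps_diff_nth scale_right_distrib del: of_nat_Suc)
qed

lemma vector_space_fps_scale:
  assumes "vector_space s"
  shows "vector_space (fps_scale s)"
proof -
  interpret vector_space s by fact
  show ?thesis
    by unfold_locales (auto intro!: fps_ext simp: scale_left_distrib scale_right_distrib)
qed

definition triples :: "nat \<Rightarrow> (nat \<times> nat \<times> nat) set" where
  "triples n = {(i, j, k). i + j + k = n}"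

lemma sum_triples_swap: "(\<Sum>(i,j,k)\<in>triples n. f i j k) = (\<Sum>(i,j,k)\<in>triples n. f j i k)"
  by (rule sum.reindex_bij_witness[of _ "\<lambda>(i,j,k). (j,i,k)" "\<lambda>(i,j,k). (j,i,k)"]) (auto simp: triples_def)

lemma sum_triples_rotate: "(\<Sum>(i,j,k)\<in>triples n. f i j k) = (\<Sum>(i,j,k)\<in>triples n. f j k i)"
  by (rule sum.reindex_bij_witness[of _ "\<lambda>(i,j,k). (j,k,i)" "\<lambda>(i,j,k). (k,i,j)"]) (auto simp: triples_def)

context biadditive
begin

lemma conv_add_left: "conv B (f + g) h = conv B f h + conv B g h"
  by (rule fps_ext) (simp add: conv_nth add_left sum.distrib)

lemma conv_add_right: "conv B f (g + h) = conv B f g + conv B f h"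
  by (rule fps_ext) (simp add: conv_nth add_right sum.distrib)

lemma conv_const_left: "conv B (fps_const x) f $ n = B x (f $ n)"
proof -
  have "conv B (fps_const x) f $ n = (\<Sum>i\<in>{0}. B (fps_const x $ i) (f $ (n - i)))"
    unfolding conv_nth by (rule sum.mono_neutral_right) auto
  then show ?thesis by simp
qed

lemma conv_conv_left:
  "conv B (conv C f g) h $ n = (\<Sum>(i,j,k)\<in>triples n. B (C (f $ i) (g $ j)) (h $ k))"
proof -
  have "conv B (conv C f g) h $ n = (\<Sum>(m,i)\<in>(SIGMA m:{0..n}. {0..m}). B (C (f $ i) (g $ (m - i))) (h $ (n - m)))"
    by (simp add: conv_nth sum_left sum.Sigma)
  also have "\<dots> = (\<Sum>(i,j,k)\<in>triples n. B (C (f $ i) (g $ j)) (h $ k))"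
    by (rule sum.reindex_bij_witness[of _ "\<lambda>(i,j,k). (i + j, i)" "\<lambda>(m,i). (i, m - i, n - m)"])
       (auto simp: triples_def)
  finally show ?thesis .
qed

lemma conv_conv_right:
  "conv B f (conv C g h) $ n = (\<Sum>(i,j,k)\<in>triples n. B (f $ i) (C (g $ j) (h $ k)))"
proof -
  have "conv B f (conv C g h) $ n = (\<Sum>(m,i)\<in>(SIGMA m:{0..n}. {0..n-m}). B (f $ m) (C (g $ i) (h $ (n - m - i))))"
    by (simp add: conv_nth sum_right sum.Sigma)
  also have "\<dots> = (\<Sum>(i,j,k)\<in>triples n. B (f $ i) (C (g $ j) (h $ k)))"
    by (rule sum.reindex_bij_witness[of _ "\<lambda>(i,j,k). (i, j)" "\<lambda>(m,i). (m, i, n - m - i)"])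
       (auto simp: triples_def)
  finally show ?thesis .
qed

lemma fps_diff_conv:
  assumes s: "vector_space s"
    and left: "\<And>c x y. B (s1 c x) y = s c (B x y)" and right: "\<And>c x y. B x (s2 c y) = s c (B x y)"
  shows "fps_diff s (conv B f g) = conv B (fps_diff s1 f) g + conv B f (fps_diff s2 g)"
proof (rule fps_ext)
  fix n
  interpret vector_space s by fact
  let ?b = "\<lambda>i. B (f $ i) (g $ (Suc n - i))"
  have "fps_diff s (conv B f g) $ n = (\<Sum>i=0..Suc n. s (of_nat (Suc n)) (?b i))"
    by (simp add: fps_diff_nth conv_nth scale_sum_right del: of_nat_Suc sum.cl_ivl_Suc)
  also have "\<dots> = (\<Sum>i=0..Suc n. s (of_nat i) (?b i) + s (of_nat (Suc n - i)) (?b i))"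
  proof (rule sum.cong)
    fix i assume "i \<in> {0..Suc n}"
    then have "of_nat (Suc n) = (of_nat i + of_nat (Suc n - i) :: 'd)"
      by (metis atLeastAtMost_iff le_add_diff_inverse of_nat_add)
    then show "s (of_nat (Suc n)) (?b i) = s (of_nat i) (?b i) + s (of_nat (Suc n - i)) (?b i)"
      by (simp only: scale_left_distrib)
  qed simp
  also have "\<dots> = (\<Sum>i=0..Suc n. s (of_nat i) (?b i)) + (\<Sum>i=0..Suc n. s (of_nat (Suc n - i)) (?b i))"
    by (rule sum.distrib)
  also have "(\<Sum>i=0..Suc n. s (of_nat i) (?b i)) = conv B (fps_diff s1 f) g $ n"
    by (simp add: sum.atLeast0_atMost_Suc_shift conv_nth fps_diff_nth left del: of_nat_Suc sum.cl_ivl_Suc)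
  also have "(\<Sum>i=0..Suc n. s (of_nat (Suc n - i)) (?b i)) = conv B f (fps_diff s2 g) $ n"
    by (simp add: conv_nth fps_diff_nth right Suc_diff_le del: of_nat_Suc of_nat_diff)
  finally show "fps_diff s (conv B f g) $ n = (conv B (fps_diff s1 f) g + conv B f (fps_diff s2 g)) $ n"
    by simp
qed

end

lemma (in lie_representation) biadditive_rho: "biadditive rho"
  by unfold_locales (simp_all add: rho_add_left rho_add_right)

lemma (in lie_algebra) biadditive_bracket: "biadditive bracket"
  by unfold_locales (simp_all add: bracket_add_left bracket_add_right)

lemma fps_diff_fps_const:
  assumes "vector_space s"
  shows "fps_diff s (fps_const x) = 0"
proof -
  interpret vector_space s by fact
  show ?thesis by (rule fps_ext) (simp add: fps_diff_nth)
qed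

text \<open>
  Alternation does not follow coefficientwise from alternation; it is deduced from antisymmetry, which
  is where \<open>2 \<noteq> 0\<close> enters.
\<close>

lemma fps_lie_algebra:
  fixes s :: "'k::field \<Rightarrow> 'l::ab_group_add \<Rightarrow> 'l"
  assumes "lie_algebra s br" and two: "(2::'k) \<noteq> 0"
  shows "lie_algebra (fps_scale s) (conv br)"
proof -
  interpret lie_algebra s br by fact
  interpret B: biadditive br by (rule biadditive_bracket)
  interpret F: vector_space "fps_scale s"
    by (rule vector_space_fps_scale) unfold_locales
  have flip: "conv br g f = - conv br f g" for f g
    by (rule fps_ext, subst conv_flip) (simp add: conv_nth bracket_antisym[of "f $ i" for i] sum_negf)
  show ?thesis
  proof
    fix f g h :: "'l fps" and c :: 'k
    show "conv br (f + g) h = conv br f h + conv br g h" by (rule B.conv_add_left)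
    show "conv br f (g + h) = conv br f g + conv br f h" by (rule B.conv_add_right)
    show "conv br (fps_scale s c f) g = fps_scale s c (conv br f g)"
      by (rule fps_ext) (simp add: conv_nth bracket_scale_left scale_sum_right)
    show "conv br f (fps_scale s c g) = fps_scale s c (conv br f g)"
      by (rule fps_ext) (simp add: conv_nth bracket_scale_right scale_sum_right)
    show "conv br f f = 0"
    proof (rule fps_ext)
      fix n
      have "conv br f f $ n + conv br f f $ n = 0"
        by (metis flip add.right_inverse fps_neg_nth)
      then have "s 2 (conv br f f $ n) = 0"
        by (metis one_add_one scale_left_distrib scale_one)
      then show "conv br f f $ n = 0 $ n" using two by simp
    qed
    show "conv br f (conv br g h) + conv br g (conv br h f) + conv br h (conv br f g) = 0"
    proof (rule fps_ext)
      fix n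
      have g: "conv br g (conv br h f) $ n = (\<Sum>(i,j,k)\<in>triples n. br (g $ j) (br (h $ k) (f $ i)))"
        unfolding B.conv_conv_right by (rule sum_triples_rotate)
      have h: "conv br h (conv br f g) $ n = (\<Sum>(i,j,k)\<in>triples n. br (h $ k) (br (f $ i) (g $ j)))"
        unfolding B.conv_conv_right by (subst sum_triples_rotate, subst sum_triples_rotate) (rule refl)
      show "(conv br f (conv br g h) + conv br g (conv br h f) + conv br h (conv br f g)) $ n = 0 $ n"
        unfolding fps_add_nth B.conv_conv_right[of f br] g h sum.distrib[symmetric]
        by (rule trans[OF sum.neutral]) (auto simp: jacobi)
    qed
  qed
qed

lemma fps_lie_representation:
  fixes s :: "'k::field \<Rightarrow> 'l::ab_group_add \<Rightarrow> 'l"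
  assumes "lie_representation s br sV rho" and two: "(2::'k) \<noteq> 0"
  shows "lie_representation (fps_scale s) (conv br) (fps_scale sV) (conv rho)"
proof -
  interpret lie_representation s br sV rho by fact
  interpret L: lie_algebra "fps_scale s" "conv br"
    by (rule fps_lie_algebra[OF _ two]) unfold_locales
  interpret B: biadditive rho by (rule biadditive_rho)
  interpret FV: vector_space "fps_scale sV"
    by (rule vector_space_fps_scale) unfold_locales
  show ?thesis
  proof
    fix f g and h k :: "'a fps" and c :: 'k
    show "conv rho (f + g) h = conv rho f h + conv rho g h" by (rule B.conv_add_left)
    show "conv rho f (h + k) = conv rho f h + conv rho f k" by (rule B.conv_add_right)
    show "conv rho (fps_scale s c f) h = fps_scale sV c (conv rho f h)"
      by (rule fps_ext) (simp add: conv_nth rho_scale_left V.scale_sum_right)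
    show "conv rho f (fps_scale sV c h) = fps_scale sV c (conv rho f h)"
      by (rule fps_ext) (simp add: conv_nth rho_scale_right V.scale_sum_right)
    show "conv rho (conv br f g) h = conv rho f (conv rho g h) - conv rho g (conv rho f h)"
    proof (rule fps_ext)
      fix n
      have "conv rho g (conv rho f h) $ n = (\<Sum>(i,j,k)\<in>triples n. rho (g $ j) (rho (f $ i) (h $ k)))"
        unfolding B.conv_conv_right by (rule sum_triples_swap)
      then show "conv rho (conv br f g) h $ n = (conv rho f (conv rho g h) - conv rho g (conv rho f h)) $ n"
        by (simp add: B.conv_conv_left B.conv_conv_right rho_bracket sum_subtractf case_prod_unfold)
    qed
  qed
qed

lemma fps_crossed_homomorphism:
  fixes s :: "'k::field \<Rightarrow> 'l::ab_group_add \<Rightarrow> 'l"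
  assumes "crossed_homomorphism s br sV rho dd" and two: "(2::'k) \<noteq> 0"
  shows "crossed_homomorphism (fps_scale s) (conv br) (fps_scale sV) (conv rho)
    (\<lambda>f. Abs_fps (\<lambda>n. dd (f $ n)))"
proof -
  interpret crossed_homomorphism s br sV rho dd by fact
  interpret L: lie_representation "fps_scale s" "conv br" "fps_scale sV" "conv rho"
    by (rule fps_lie_representation[OF _ two]) unfold_locales
  have dd_0: "dd 0 = 0" using dd_add[of 0 0] by simp
  have dd_sum: "dd (sum f S) = (\<Sum>i\<in>S. dd (f i))" for f and S :: "nat set"
    by (induction S rule: infinite_finite_induct) (simp_all add: dd_add dd_0)
  show ?thesis
  proof
    fix f g :: "'l fps"
    show "Abs_fps (\<lambda>n. dd (conv br f g $ n)) =
      conv rho f (Abs_fps (\<lambda>n. dd (g $ n))) - conv rho g (Abs_fps (\<lambda>n. dd (f $ n)))"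
      by (subst (2) conv_flip, rule fps_ext) (simp add: conv_nth dd_sum dd_bracket sum_subtractf)
  qed (auto intro!: fps_ext simp: dd_add dd_scale)
qed

lemma fps_diff_crossed_homomorphism:
  fixes s :: "'k::field \<Rightarrow> 'l::ab_group_add \<Rightarrow> 'l"
  assumes "lie_algebra s br" and two: "(2::'k) \<noteq> 0"
  shows "crossed_homomorphism (fps_scale s) (conv br) (fps_scale s) (conv br) (fps_diff s)"
proof -
  interpret lie_algebra s br by fact
  interpret B: biadditive br by (rule biadditive_bracket)
  interpret F: lie_algebra "fps_scale s" "conv br"
    by (rule fps_lie_algebra[OF _ two]) unfold_locales
  interpret R: lie_representation "fps_scale s" "conv br" "fps_scale s" "conv br"
    by (rule F.adjoint_representation)
  have vs: "vector_space s" by unfold_locales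
  show ?thesis
  proof
    fix f g
    show "fps_diff s (f + g) = fps_diff s f + fps_diff s g" by (rule fps_diff_add[OF vs])
    show "fps_diff s (fps_scale s c f) = fps_scale s c (fps_diff s f)" for c
      by (rule fps_ext) (simp add: fps_diff_nth mult.commute del: of_nat_Suc)
    show "fps_diff s (conv br f g) = conv br f (fps_diff s g) - conv br g (fps_diff s f)"
      by (subst B.fps_diff_conv[OF vs bracket_scale_left bracket_scale_right])
         (simp add: F.bracket_antisym[of "fps_diff s f" g])
  qed
qed


section \<open>Integrating polynomials from \<open>0\<close> to \<open>1\<close>\<close>

text \<open>
  The series is a polynomial of degree at most \<open>n\<close>, and its constant coefficient, its coefficient of
  degree \<open>n\<close> and its value at \<open>t = 1\<close> are the three given elements. Each of these three is
  multiplicative for Cauchy products when the degree bounds are added, so they can be read off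
  expressions that are built from \<open>tx + y\<close>.
\<close>

definition interpolates :: "nat \<Rightarrow> 'v::ab_group_add fps \<Rightarrow> 'v \<Rightarrow> 'v \<Rightarrow> 'v \<Rightarrow> bool" where
  "interpolates n f a b c \<longleftrightarrow>
     f $ 0 = a \<and> f $ n = b \<and> (\<forall>m>n. f $ m = 0) \<and> (\<Sum>i=0..n. f $ i) = c"

text \<open>
  The polynomial \<open>tx + y\<close>.
\<close>

definition line :: "'v::zero \<Rightarrow> 'v \<Rightarrow> 'v fps" where
  "line x y = Abs_fps (\<lambda>n. if n = 0 then y else if n = 1 then x else 0)"

lemma line_nth: "line x y $ n = (if n = 0 then y else if n = 1 then x else 0)"
  by (simp add: line_def)

lemma interpolates_line: "interpolates 1 (line x y) y x (x + y)"
  by (simp add: interpolates_def line_nth add.commute)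

lemma interpolates_const: "interpolates 0 (fps_const x) x x x"
  by (simp add: interpolates_def)

lemma interpolates_add:
  "\<lbrakk>interpolates n f a b c; interpolates n g a' b' c'\<rbrakk> \<Longrightarrow> interpolates n (f + g) (a + a') (b + b') (c + c')"
  by (simp add: interpolates_def sum.distrib)

lemma interpolates_diff:
  "\<lbrakk>interpolates n f a b c; interpolates n g a' b' c'\<rbrakk> \<Longrightarrow> interpolates n (f - g) (a - a') (b - b') (c - c')"
  by (simp add: interpolates_def sum_subtractf)

lemma interpolates_zero: "interpolates n 0 0 0 0"
  by (simp add: interpolates_def)

lemma interpolates_sum:
  "(\<And>i. i \<in> S \<Longrightarrow> interpolates n (f i) (a i) (b i) (c i)) \<Longrightarrow>
    interpolates n (sum f S) (sum a S) (sum b S) (sum c S)"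
  by (induction S rule: infinite_finite_induct) (simp_all add: interpolates_zero interpolates_add)

lemma (in vector_space) interpolates_scale:
  "interpolates n f a b c \<Longrightarrow> interpolates n (fps_scale scale r f) (scale r a) (scale r b) (scale r c)"
  by (auto simp: interpolates_def scale_sum_right)

lemma (in biadditive) interpolates_conv:
  assumes f: "interpolates n f a b c" and g: "interpolates m g a' b' c'"
  shows "interpolates (n + m) (conv B f g) (B a a') (B b b') (B c c')"
  unfolding interpolates_def
proof (intro conjI allI impI)
  have fz: "f $ i = 0" if "i > n" for i using f that by (simp add: interpolates_def)
  have gz: "g $ i = 0" if "i > m" for i using g that by (simp add: interpolates_def)
  have ends: "f $ 0 = a" "g $ 0 = a'" "f $ n = b" "g $ m = b'"
    using f g by (simp_all only: interpolates_def)
  show "conv B f g $ 0 = B a a'"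
    by (simp add: conv_nth ends)
  have "conv B f g $ (n + m) = (\<Sum>i\<in>{n}. B (f $ i) (g $ (n + m - i)))"
    unfolding conv_nth
  proof (rule sum.mono_neutral_right)
    show "\<forall>i\<in>{0..n + m} - {n}. B (f $ i) (g $ (n + m - i)) = 0"
    proof
      fix i assume "i \<in> {0..n + m} - {n}"
      then have "i > n \<or> n + m - i > m" by auto
      then show "B (f $ i) (g $ (n + m - i)) = 0" using fz gz by auto
    qed
  qed auto
  then show "conv B f g $ (n + m) = B b b'"
    by (simp add: ends)
  fix k assume "n + m < k"
  show "conv B f g $ k = 0"
    unfolding conv_nth
  proof (rule sum.neutral, rule ballI)
    fix i
    have "i > n \<or> k - i > m" using \<open>n + m < k\<close> by auto
    then show "B (f $ i) (g $ (k - i)) = 0" using fz gz by auto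
  qed
next
  have fz: "f $ i = 0" if "i > n" for i using f that by (simp add: interpolates_def)
  have gz: "g $ i = 0" if "i > m" for i using g that by (simp add: interpolates_def)
  have "(\<Sum>k=0..n+m. conv B f g $ k) = (\<Sum>(k,i)\<in>(SIGMA k:{0..n+m}. {0..k}). B (f $ i) (g $ (k - i)))"
    by (simp add: conv_nth sum.Sigma)
  \<comment> \<open>the triangle below contains the rectangle outside of which all terms vanish\<close>
  also have "\<dots> = (\<Sum>(i,j)\<in>{(i,j). i + j \<le> n + m}. B (f $ i) (g $ j))"
    by (rule sum.reindex_bij_witness[of _ "\<lambda>(i,j). (i + j, i)" "\<lambda>(k,i). (i, k - i)"]) auto
  also have "\<dots> = (\<Sum>(i,j)\<in>{0..n} \<times> {0..m}. B (f $ i) (g $ j))"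
  proof (rule sum.mono_neutral_right)
    show "finite {(i, j). i + j \<le> n + m}"
      by (rule finite_subset[of _ "{0..n+m} \<times> {0..n+m}"]) auto
    show "\<forall>x\<in>{(i, j). i + j \<le> n + m} - {0..n} \<times> {0..m}. (case x of (i, j) \<Rightarrow> B (f $ i) (g $ j)) = 0"
    proof
      fix x assume "x \<in> {(i, j). i + j \<le> n + m} - {0..n} \<times> {0..m}"
      then have "fst x > n \<or> snd x > m" by auto
      then show "(case x of (i, j) \<Rightarrow> B (f $ i) (g $ j)) = 0"
        using fz[of "fst x"] gz[of "snd x"] by (auto simp: case_prod_unfold)
    qed
  qed auto
  also have "\<dots> = B (\<Sum>i=0..n. f $ i) (\<Sum>j=0..m. g $ j)"
    by (simp only: sum.cartesian_product[symmetric] sum_left[of "($) f"]) (simp only: sum_right)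
  also have "(\<Sum>i=0..n. f $ i) = c" using f by (simp only: interpolates_def)
  also have "(\<Sum>j=0..m. g $ j) = c'" using g by (simp only: interpolates_def)
  finally show "(\<Sum>k=0..n+m. conv B f g $ k) = B c c'" .
qed

lemma interpolates_funpow:
  fixes B :: "'a::ab_group_add \<Rightarrow> 'b::ab_group_add \<Rightarrow> 'b"
  assumes "biadditive B" "interpolates 1 w a b c" and "interpolates m g a' b' c'"
  shows "interpolates (n + m) ((conv B w ^^ n) g) ((B a ^^ n) a') ((B b ^^ n) b') ((B c ^^ n) c')"
proof (induction n)
  case (Suc n)
  have "interpolates (1 + (n + m)) (conv B w ((conv B w ^^ n) g))
    (B a ((B a ^^ n) a')) (B b ((B b ^^ n) b')) (B c ((B c ^^ n) c'))"
    by (rule biadditive.interpolates_conv) (use assms Suc in simp_all)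
  then show ?case by simp
qed (use assms(3) in simp)

text \<open>
  The integral of a polynomial over \<open>0 \<le> t \<le> 1\<close>. The coefficient of \<open>t\<^sup>p\<^sup>-\<^sup>1\<close>, which has no
  primitive in characteristic \<open>p\<close>, is left out.
\<close>

definition Int01 :: "nat \<Rightarrow> ('k::field \<Rightarrow> 'v::ab_group_add \<Rightarrow> 'v) \<Rightarrow> 'v fps \<Rightarrow> 'v" where
  "Int01 p s f = (\<Sum>i = 1..p - 1. s (1 / of_nat i) (f $ (i - 1)))"

lemma of_nat_neq_0_less_prime:
  assumes "prime p" "of_nat p = (0::'k::field)" "0 < i" "i < p"
  shows "of_nat i \<noteq> (0::'k)"
  using of_nat_mult_eq_0_imp_eq_0[OF assms, of 1] by auto

text \<open>
  The fundamental theorem of calculus for polynomials of degree at most \<open>p\<close>. The derivative does not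
  see the constant coefficient \<open>a\<close> and the coefficient \<open>b\<close> of \<open>t\<^sup>p\<close>, so both are subtracted.
\<close>

lemma Int01_fps_diff:
  fixes s :: "'k::field \<Rightarrow> 'v::ab_group_add \<Rightarrow> 'v"
  assumes "vector_space s" "prime p" "of_nat p = (0::'k)" "interpolates p g a b c"
  shows "Int01 p s (fps_diff s g) = c - a - b"
proof -
  interpret vector_space s by fact
  have "Int01 p s (fps_diff s g) = (\<Sum>i = 1..p - 1. g $ i)"
    unfolding Int01_def
  proof (rule sum.cong)
    fix i assume i: "i \<in> {1..p - 1}"
    then have "of_nat i \<noteq> (0::'k)" by (intro of_nat_neq_0_less_prime[OF assms(2,3)]) auto
    then show "s (1 / of_nat i) (fps_diff s g $ (i - 1)) = g $ i"
      using i by (simp add: fps_diff_nth del: of_nat_Suc)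
  qed simp
  moreover have "(\<Sum>i = 0..p. g $ i) = g $ 0 + (\<Sum>i = 1..p - 1. g $ i) + g $ p"
  proof -
    have p: "p = Suc (p - 1)" using prime_gt_0_nat[OF assms(2)] by simp
    have "(\<Sum>i = 0..p. g $ i) = (\<Sum>i = 0..p - 1. g $ i) + g $ p"
      using sum.atLeast0_atMost_Suc[of "($) g" "p - 1"] p by metis
    then show ?thesis by (simp add: sum.atLeast_Suc_atMost)
  qed
  ultimately show ?thesis using assms(4) unfolding interpolates_def by (simp only: algebra_simps)
qed

lemma jacobson_Lambda_eq_Int01:
  assumes "lie_algebra s br"
  shows "jacobson_Lambda p s br x y = Int01 p s ((conv br (line x y) ^^ (p - 1)) (fps_const x))"
proof -
  interpret lie_algebra s br by fact
  interpret B: biadditive br by (rule biadditive_bracket)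
  have pencil: "poly.coeff (ad_pencil br x y f) n = (if n = 0 then 0 else br x (poly.coeff f (n - 1))) + br y (poly.coeff f n)" for f n
    by (cases n) (simp_all add: ad_pencil_def coeff_map_poly coeff_pCons)
  have conv: "conv br (line x y) f $ n = (if n = 0 then 0 else br x (f $ (n - 1))) + br y (f $ n)" for f n
  proof (cases n)
    case 0
    then show ?thesis by (simp add: conv_nth line_nth)
  next
    case (Suc m)
    have "conv br (line x y) f $ n = (\<Sum>i\<in>{0,1}. br (line x y $ i) (f $ (n - i)))"
      unfolding conv_nth by (rule sum.mono_neutral_right) (auto simp: line_nth Suc)
    then show ?thesis by (simp add: line_nth Suc add.commute)
  qed
  have "poly.coeff ((ad_pencil br x y ^^ m) [:x:]) n = (conv br (line x y) ^^ m) (fps_const x) $ n" for m n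
  proof (induction m arbitrary: n)
    case 0
    then show ?case by (simp add: coeff_pCons split: nat.splits)
  next
    case (Suc m)
    then show ?case by (simp add: pencil conv)
  qed
  then show ?thesis
    by (simp add: jacobson_Lambda_def jacobson_s_def Int01_def)
qed

lemma fps_diff_line:
  assumes "vector_space s"
  shows "fps_diff s (line x y) = fps_const x"
proof -
  interpret vector_space s by fact
  show ?thesis by (rule fps_ext) (simp add: fps_diff_nth line_nth)
qed


section \<open>The Jacobson form \<open>\<Lambda>\<close> as a cocycle\<close>

lemma odd_prime_two_neq_0:
  assumes "prime p" "of_nat p = (0::'k::field)" "odd p"
  shows "(2::'k) \<noteq> 0"
proof -
  have "p \<noteq> 2" using assms(3) by auto
  then have "2 < p" using prime_ge_2_nat[OF assms(1)] by simp
  then show ?thesis using of_nat_neq_0_less_prime[OF assms(1,2), of 2] by simp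
qed

lemma (in lie_representation) derivation_rho_power:
  assumes "\<And>v w. dV (v + w) = dV v + dV w"
    and "\<And>x v. dV (rho x v) = rho (dL x) v + rho x (dV v)"
  shows "dV ((rho x ^^ n) v) = (rho x ^^ n) (dV v) +
    (\<Sum>j<n. (rho x ^^ (n - 1 - j)) (rho (dL x) ((rho x ^^ j) v)))"
proof (induction n)
  case (Suc n)
  have "dV ((rho x ^^ Suc n) v) = rho (dL x) ((rho x ^^ n) v) + rho x (dV ((rho x ^^ n) v))"
    by (simp add: assms(2))
  also have "rho x (dV ((rho x ^^ n) v)) = (rho x ^^ Suc n) (dV v) +
      (\<Sum>j<n. rho x ((rho x ^^ (n - 1 - j)) (rho (dL x) ((rho x ^^ j) v))))"
    by (simp add: Suc.IH rho_add_right rho_sum_right)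
  also have "(\<Sum>j<n. rho x ((rho x ^^ (n - 1 - j)) (rho (dL x) ((rho x ^^ j) v)))) =
      (\<Sum>j<n. (rho x ^^ (Suc n - 1 - j)) (rho (dL x) ((rho x ^^ j) v)))"
  proof (rule sum.cong)
    fix j assume "j \<in> {..<n}"
    then have "Suc n - 1 - j = Suc (n - 1 - j)" by auto
    then show "rho x ((rho x ^^ (n - 1 - j)) (rho (dL x) ((rho x ^^ j) v))) =
      (rho x ^^ (Suc n - 1 - j)) (rho (dL x) ((rho x ^^ j) v))" by simp
  qed simp
  finally show ?case by (simp add: add_ac)
qed simp

lemma (in lie_representation) fps_diff_conv_rho:
  "fps_diff scaleV (conv rho f g) = conv rho (fps_diff scale f) g + conv rho f (fps_diff scaleV g)"
  by (rule biadditive.fps_diff_conv[OF biadditive_rho])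
     (simp_all add: rho_scale_left rho_scale_right V.vector_space_axioms)

text \<open>
  Integrating the closed \<open>1\<close>-form of \<open>dd_ad_power_pred_prime\<close> along the segment from \<open>y\<close> to \<open>x + y\<close>. The
  contributions of \<open>y\<close> and \<open>x\<close> on the right are the constant and the top coefficient of the primitive
  \<open>\<rho>(w)\<^sup>p\<^sup>-\<^sup>1(\<partial>w)\<close>.
\<close>

lemma (in crossed_homomorphism) dd_jacobson_Lambda:
  assumes p: "prime p" "of_nat p = (0::'a)" "odd p"
  shows "dd (jacobson_Lambda p scale bracket x y) =
    (rho (x + y) ^^ (p - 1)) (dd (x + y)) - (rho x ^^ (p - 1)) (dd x) - (rho y ^^ (p - 1)) (dd y)"
proof -
  note two = odd_prime_two_neq_0[OF p]
  \<comment> \<open>the coefficientwise extension of the cocycle\<close>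
  define DD where "DD = (\<lambda>f. Abs_fps (\<lambda>n. dd (f $ n)))"
  interpret F: crossed_homomorphism "fps_scale scale" "conv bracket" "fps_scale scaleV" "conv rho" DD
    unfolding DD_def by (rule fps_crossed_homomorphism[OF _ two]) unfold_locales
  have dd_0: "dd 0 = 0" using dd_add[of 0 0] by simp
  let ?w = "line x y"
  let ?f = "(conv bracket ?w ^^ (p - 1)) (fps_const x)"
  let ?g = "(conv rho ?w ^^ (p - 1)) (DD ?w)"
  have DD_w: "DD ?w = line (dd x) (dd y)" and DD_x: "DD (fps_const x) = fps_const (dd x)"
    by (auto intro!: fps_ext simp: DD_def line_nth dd_0)
  have diff_g: "fps_diff scaleV ?g = DD ?f"
    unfolding F.dd_ad_power_pred_prime[OF p(1,2)]
    by (subst F.derivation_rho_power[where dV = "fps_diff scaleV" and dL = "fps_diff scale"])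
       (simp_all add: fps_diff_add fps_diff_conv_rho fps_diff_line V.vector_space_axioms vector_space_axioms DD_w DD_x)
  have I: "interpolates (p - 1 + 1) ?g ((rho y ^^ (p - 1)) (dd y)) ((rho x ^^ (p - 1)) (dd x))
      ((rho (x + y) ^^ (p - 1)) (dd x + dd y))"
    unfolding DD_w by (rule interpolates_funpow[OF biadditive_rho interpolates_line interpolates_line])
  have "p - 1 + 1 = p" using prime_gt_0_nat[OF p(1)] by simp
  with I have int: "Int01 p scaleV (DD ?f) =
      (rho (x + y) ^^ (p - 1)) (dd x + dd y) - (rho y ^^ (p - 1)) (dd y) - (rho x ^^ (p - 1)) (dd x)"
    unfolding diff_g[symmetric] by (metis Int01_fps_diff[OF V.vector_space_axioms p(1,2)])
  have dd_sum: "dd (sum f S) = (\<Sum>i\<in>S. dd (f i))" for f and S :: "nat set"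
    by (induction S rule: infinite_finite_induct) (simp_all add: dd_add dd_0)
  have "jacobson_Lambda p scale bracket x y = Int01 p scale ?f"
    by (rule jacobson_Lambda_eq_Int01) unfold_locales
  then have "dd (jacobson_Lambda p scale bracket x y) = Int01 p scaleV (DD ?f)"
    by (simp add: Int01_def dd_sum dd_scale DD_def)
  also note int
  also have "(rho (x + y) ^^ (p - 1)) (dd x + dd y) - (rho y ^^ (p - 1)) (dd y) - (rho x ^^ (p - 1)) (dd x) =
      (rho (x + y) ^^ (p - 1)) (dd (x + y)) - (rho x ^^ (p - 1)) (dd x) - (rho y ^^ (p - 1)) (dd y)"
    by (simp add: dd_add diff_diff_eq add.commute)
  finally show ?thesis .
qed

text \<open>
  Jacobson's formula for \<open>(a + b)\<^sup>p\<close> in an associative algebra, applied to operators; it is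
  \<open>dd_jacobson_Lambda\<close> for the inner cocycle \<open>x \<mapsto> \<rho>(x) v\<close>.
\<close>

lemma (in lie_representation) rho_power_prime_add:
  assumes p: "prime p" "of_nat p = (0::'k)" "odd p"
  shows "(rho (x + y) ^^ p) v =
    (rho x ^^ p) v + (rho y ^^ p) v + rho (jacobson_Lambda p scale bracket x y) v"
proof -
  interpret C: crossed_homomorphism scale bracket scaleV rho "\<lambda>x. rho x v"
    by (rule inner_crossed_homomorphism)
  have "(rho z ^^ p) v = (rho z ^^ (p - 1)) (rho z v)" for z
    using prime_gt_0_nat[OF p(1)] by (cases p) (simp_all add: funpow_swap1)
  then show ?thesis
    using C.dd_jacobson_Lambda[OF p, of x y] by (simp add: algebra_simps)
qed

context lie_algebra
begin

abbreviation (input) "Lam p \<equiv> jacobson_Lambda p scale bracket"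

lemma coeff_ad_pencil:
  "poly.coeff (ad_pencil bracket x y f) n =
    (if n = 0 then 0 else bracket x (poly.coeff f (n - 1))) + bracket y (poly.coeff f n)"
  using biadditive.zero_right[OF biadditive_bracket]
  by (cases n) (simp_all add: ad_pencil_def coeff_map_poly coeff_pCons)

lemma jacobson_Lambda_0_left: "jacobson_Lambda p scale bracket 0 y = 0"
proof -
  have "(ad_pencil bracket 0 y ^^ m) 0 = 0" for m
    by (induction m) (simp_all add: ad_pencil_def)
  then show ?thesis by (simp add: jacobson_Lambda_def jacobson_s_def)
qed

lemma jacobson_Lambda_0_right:
  assumes "p \<ge> 2"
  shows "jacobson_Lambda p scale bracket x 0 = 0"
proof -
  interpret B: biadditive bracket by (rule biadditive_bracket)
  have "(ad_pencil bracket x 0 ^^ Suc m) [:x:] = 0" for m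
  proof (induction m)
    case 0
    show ?case by (rule poly_eqI) (simp add: coeff_ad_pencil coeff_pCons bracket_self split: nat.splits)
  next
    case (Suc m)
    then show ?case by (simp add: ad_pencil_def)
  qed
  from this[of "p - 2"] have "(ad_pencil bracket x 0 ^^ (p - 1)) [:x:] = 0"
    using assms by (metis Suc_diff_Suc Suc_1 Suc_le_lessD)
  then show ?thesis by (simp add: jacobson_Lambda_def jacobson_s_def)
qed

text \<open>
  \<open>\<Lambda>\<close> is homogeneous of degree \<open>p\<close>, so along lines it is a polynomial of degree at most \<open>p\<close> whose
  top coefficient is \<open>\<Lambda>\<close> of the directions.
\<close>

lemma interpolates_jacobson_Lambda:
  assumes "(2::'k) \<noteq> 0" "p > 0" and f: "interpolates 1 f a b c" and g: "interpolates 1 g a' b' c'"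
  shows "interpolates p (jacobson_Lambda p (fps_scale scale) (conv bracket) f g)
    (jacobson_Lambda p scale bracket a a') (jacobson_Lambda p scale bracket b b')
    (jacobson_Lambda p scale bracket c c')"
proof -
  interpret B: biadditive bracket by (rule biadditive_bracket)
  interpret F: lie_algebra "fps_scale scale" "conv bracket"
    by (rule fps_lie_algebra[OF _ assms(1)]) unfold_locales
  let ?S = "\<lambda>br x y m n. poly.coeff ((ad_pencil br x y ^^ m) [:x:]) n"
  have "interpolates (m + 1) (?S (conv bracket) f g m n)
      (?S bracket a a' m n) (?S bracket b b' m n) (?S bracket c c' m n)" for m n
  proof (induction m arbitrary: n)
    case 0
    then show ?case using f by (simp add: coeff_pCons interpolates_zero split: nat.splits)
  next
    case step: (Suc m)
    note g' = B.interpolates_conv[OF g step[of n]]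
    show ?case
    proof (cases n)
      case 0
      then show ?thesis using g' by (simp add: coeff_ad_pencil F.coeff_ad_pencil)
    next
      case (Suc n')
      then show ?thesis
        using interpolates_add[OF B.interpolates_conv[OF f step[of n']] g']
        by (simp add: coeff_ad_pencil F.coeff_ad_pencil)
    qed
  qed
  from this[of "p - 1"] show ?thesis
    unfolding jacobson_Lambda_def jacobson_s_def using assms(2)
    by (intro interpolates_sum interpolates_scale) simp_all
qed

text \<open>
  Both identities have the form \<open>C(x) = 0\<close> for an expression \<open>C\<close> that is built from \<open>\<Lambda>\<close>. By
  \<open>dd_jacobson_Lambda\<close> for \<open>d/dt\<close>, the polynomial \<open>C(tx)\<close> has derivative \<open>0\<close>, so it consists of its
  constant coefficient \<open>C(0)\<close> and its coefficient of \<open>t\<^sup>p\<close>. In both of these every \<open>\<Lambda>\<close> cancels or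
  has a zero argument.
\<close>

lemma jacobson_Lambda_cocycle_symmetric:
  assumes p: "prime p" "of_nat p = (0::'k)" "odd p"
  shows jacobson_Lambda_cocycle: "Lam p x (y + z) + Lam p y z = Lam p x y + Lam p (x + y) z"
    and jacobson_Lambda_commute: "Lam p x y = Lam p y x"
proof -
  note two = odd_prime_two_neq_0[OF p]
  interpret F: lie_algebra "fps_scale scale" "conv bracket"
    by (rule fps_lie_algebra[OF _ two]) unfold_locales
  interpret D: crossed_homomorphism "fps_scale scale" "conv bracket" "fps_scale scale" "conv bracket" "fps_diff scale"
    by (rule fps_diff_crossed_homomorphism[OF _ two]) unfold_locales
  have p2: "p \<ge> 2" using prime_ge_2_nat[OF p(1)] .
  let ?L = "jacobson_Lambda p (fps_scale scale) (conv bracket)"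
  let ?x = "line x 0" and ?y = "line 0 y" and ?z = "line 0 z"
  have [simp]: "fps_diff scale (line 0 u) = 0" for u
    by (simp add: fps_diff_line vector_space_axioms)
  have pw0 [simp]: "(conv bracket f ^^ n) 0 = 0" for f n
    by (induction n) simp_all
  have d_diff: "fps_diff scale (f - g) = fps_diff scale f - fps_diff scale g" for f g
    using D.dd_add[of "f - g" g] by (simp add: algebra_simps)
  note R = interpolates_jacobson_Lambda[OF two prime_gt_0_nat[OF p(1)]]
  have int0: "c = a + b" if "interpolates p f a b c" "fps_diff scale f = 0" for f a b c
    using Int01_fps_diff[OF vector_space_axioms p(1,2) that(1)] that(2)
    by (simp add: Int01_def algebra_simps)
  note x = interpolates_line[of x 0] and y = interpolates_line[of 0 y] and z = interpolates_line[of 0 z]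
  let ?C = "(?L ?x (?y + ?z) + ?L ?y ?z) - (?L ?x ?y + ?L (?x + ?y) ?z)"
  have "fps_diff scale ?C = 0"
    by (simp add: d_diff D.dd_add D.dd_jacobson_Lambda[OF p] add.assoc)
  with int0[OF interpolates_diff[OF interpolates_add[OF R[OF x interpolates_add[OF y z]] R[OF y z]]
      interpolates_add[OF R[OF x y] R[OF interpolates_add[OF x y] z]]]]
  show "Lam p x (y + z) + Lam p y z = Lam p x y + Lam p (x + y) z"
    by (simp add: jacobson_Lambda_0_left jacobson_Lambda_0_right[OF p2])
  let ?C = "?L ?x ?y - ?L ?y ?x"
  have "fps_diff scale ?C = 0"
    by (simp add: d_diff D.dd_add D.dd_jacobson_Lambda[OF p] add.commute)
  with int0[OF interpolates_diff[OF R[OF x y] R[OF y x]]]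
  show "Lam p x y = Lam p y x"
    by (simp add: jacobson_Lambda_0_left jacobson_Lambda_0_right[OF p2])
qed

end


section \<open>Lie--Rinehart algebras in characteristic \<open>p\<close>\<close>

context lie_rinehart_algebra
begin

lemma anchor_mult: "anchor X (a * b) = a * anchor X b + anchor X a * b"
  using anchor_derivation[of X] by (rule derivation.product_rule)

lemma anchor_linear: "Vector_Spaces.linear scale scale (anchor X)"
  using anchor_derivation[of X] by (rule derivation.axioms(1))

lemma anchor_add_right: "anchor X (a + b) = anchor X a + anchor X b"
  using module_hom.add[OF Vector_Spaces.linear.axioms(3)[OF anchor_linear]] .

lemma anchor_scale: "anchor X (scale c a) = scale c (anchor X a)"
  using module_hom.scale[OF Vector_Spaces.linear.axioms(3)[OF anchor_linear]] .

lemma scale_1_mult: "scale c 1 * a = scale c a"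
  using A.scale_mult_left[of c 1 a] by simp

lemma anchor_representation:
  "lie_representation (restrict_scalars scale smul) bracket scale anchor"
  by unfold_locales
    (simp_all add: anchor_add anchor_add_right anchor_smult anchor_scale scale_1_mult anchor_bracket)

sublocale rep: lie_representation "restrict_scalars scale smul" bracket scale anchor
  by (rule anchor_representation)

lemma anchor_module_derivation: "module_derivation smul (anchor X) (bracket X)"
  by unfold_locales (simp_all add: anchor_add_right anchor_mult bracket_add_right bracket_smult)

lemma bracket_smult_left: "bracket (smul a X) Y = smul a (bracket X Y) - smul (anchor Y a) X"
proof -
  have "bracket (smul a X) Y = - bracket Y (smul a X)" by (rule bracket_antisym)
  also have "\<dots> = smul a (- bracket Y X) - smul (anchor Y a) X"
    by (simp add: bracket_smult M.scale_minus_right)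
  also have "- bracket Y X = bracket X Y" using bracket_antisym[of X Y] by simp
  finally show ?thesis .
qed

lemma scaled_bracket_power_self:
  "((\<lambda>X. smul a (bracket Z X)) ^^ n) (smul b Z) = smul ((anchor (smul a Z) ^^ n) b) Z"
  by (induction n) (simp_all add: bracket_smult bracket_self anchor_smult)

text \<open>
  The bracket with \<open>aZ\<close> differs from the operator \<open>T = a ad\<^sub>Z\<close> by multiples of \<open>Z\<close>, and \<open>T\<close> acts on
  these multiples through the anchor of \<open>aZ\<close> since \<open>[Z, Z] = 0\<close>.
\<close>

lemma ad_smult_power:
  "(bracket (smul a Z) ^^ n) W = ((\<lambda>X. smul a (bracket Z X)) ^^ n) W
    - smul (\<Sum>i<n. (anchor (smul a Z) ^^ i) (anchor ((bracket (smul a Z) ^^ (n - 1 - i)) W) a)) Z"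
proof (induction n)
  case (Suc n)
  let ?T = "\<lambda>X. smul a (bracket Z X)" and ?E = "anchor (smul a Z)" and ?ad = "bracket (smul a Z)"
  let ?s = "\<Sum>i<n. (?E ^^ i) (anchor ((?ad ^^ (n - 1 - i)) W) a)"
  have T_diff: "?T (X - Y) = ?T X - ?T Y" for X Y
    using bracket_add_right[of Z "X - Y" Y] by (simp add: M.scale_right_distrib[symmetric] eq_diff_eq)
  have "(?ad ^^ Suc n) W = ?T ((?ad ^^ n) W) - smul (anchor ((?ad ^^ n) W) a) Z"
    by (simp add: bracket_smult_left)
  also have "?T ((?ad ^^ n) W) = (?T ^^ Suc n) W - smul (?E ?s) Z"
    unfolding Suc.IH T_diff by (simp add: bracket_smult bracket_self anchor_smult)
  also have "\<dots> - smul (anchor ((?ad ^^ n) W) a) Z = (?T ^^ Suc n) W - smul (anchor ((?ad ^^ n) W) a + ?E ?s) Z"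
    by (simp add: M.scale_left_distrib algebra_simps)
  also have "anchor ((?ad ^^ n) W) a + ?E ?s = (\<Sum>i<Suc n. (?E ^^ i) (anchor ((?ad ^^ (Suc n - 1 - i)) W) a))"
    by (subst sum.lessThan_Suc_shift) (simp add: rep.rho_sum_right)
  finally show ?case .
qed simp

lemma of_nat_char_A: "of_nat p = (0::'k) \<Longrightarrow> of_nat p = (0::'a)"
proof -
  have "of_nat n = scale (of_nat n) 1" for n
    by (induction n) (simp_all add: A.scale_left_distrib)
  then show "of_nat p = (0::'k) \<Longrightarrow> of_nat p = (0::'a)" by simp
qed

text \<open>
  The correction term of Hochschild's formula: in a restricted Lie--Rinehart algebra,
  \<open>(aZ)\<^sup>[\<^sup>p\<^sup>] = a\<^sup>p Z\<^sup>[\<^sup>p\<^sup>] + hochschild_term p a Z\<close>.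
\<close>

definition hochschild_term :: "nat \<Rightarrow> 'a \<Rightarrow> 'l \<Rightarrow> 'l" where
  "hochschild_term p a Z = smul ((anchor (smul a Z) ^^ (p - 1)) a) Z"

lemma ad_smult_hochschild:
  assumes p: "prime p" "of_nat p = (0::'k)" "odd p"
  shows "(bracket (smul a Z) ^^ p) W = smul (a ^ p) ((bracket Z ^^ p) W) + bracket (hochschild_term p a Z) W"
proof -
  interpret Z: module_derivation smul "anchor Z" "bracket Z" by (rule anchor_module_derivation)
  let ?T = "\<lambda>X. smul a (bracket Z X)" and ?E = "anchor (smul a Z)"
  have E: "?E = (\<lambda>b. a * anchor Z b)" by (rule ext) (simp add: anchor_smult)
  have pw: "(f ^^ p) v = (f ^^ (p - 1)) (f v)" for f :: "'x \<Rightarrow> 'x" and v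
    using prime_gt_0_nat[OF p(1)] by (cases p) (simp_all add: funpow_swap1)
  have "(?T ^^ p) W = smul ((?E ^^ (p - 1)) a) (bracket Z W) + smul (a ^ p) ((bracket Z ^^ p) W)"
    unfolding pw E by (rule Z.hochschild[OF p(1) of_nat_char_A[OF p(2)]])
  then show ?thesis
    unfolding ad_smult_power[where n = p] rep.sum_rho_ad_power_prime[OF p] hochschild_term_def bracket_smult_left
    by simp
qed

lemma anchor_smult_hochschild:
  assumes p: "prime p" "of_nat p = (0::'k)"
  shows "(anchor (smul a Z) ^^ p) b = a ^ p * (anchor Z ^^ p) b + anchor (hochschild_term p a Z) b"
proof -
  note Z = module_derivation.hochschild[OF module_derivation.on_coefficients[OF anchor_module_derivation] p(1) of_nat_char_A[OF p(2)]]
  have E: "anchor (smul a Z) = (\<lambda>b. a * anchor Z b)" by (rule ext) (simp add: anchor_smult)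
  have pw: "(f ^^ p) v = (f ^^ (p - 1)) (f v)" for f :: "'x \<Rightarrow> 'x" and v
    using prime_gt_0_nat[OF p(1)] by (cases p) (simp_all add: funpow_swap1)
  show ?thesis
    unfolding hochschild_term_def anchor_smult unfolding E pw[of "anchor Z"] pw[of "\<lambda>b. a * anchor Z b"]
    by (subst Z) (simp add: add.commute)
qed

text \<open>
  The compatibility of the two ways to compute \<open>(a (x Z))\<^sup>[\<^sup>p\<^sup>]\<close>. It is Hochschild's formula for the
  derivation \<open>xZ\<close> of the coefficients.
\<close>

lemma hochschild_term_mult:
  assumes p: "prime p" "of_nat p = (0::'k)"
  shows "hochschild_term p (a * x) Z = smul (a ^ p) (hochschild_term p x Z) + hochschild_term p a (smul x Z)"
proof -
  note Z = module_derivation.hochschild[OF module_derivation.on_coefficients[OF anchor_module_derivation] p(1) of_nat_char_A[OF p(2)]]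
  have E: "anchor (smul (a * x) Z) = (\<lambda>b. a * anchor (smul x Z) b)"
    by (rule ext) (simp add: anchor_smult mult.assoc)
  show ?thesis
    unfolding hochschild_term_def E Z
    by (simp add: M.scale_left_distrib anchor_smult mult.assoc E)
qed

text \<open>
  The formal derivative of Hochschild's formula: if \<open>X\<^sup>[\<^sup>p\<^sup>]\<close> had derivative \<open>ad\<^sub>X\<^sup>p\<^sup>-\<^sup>1(X')\<close>, then this
  identity would result from differentiating \<open>(aZ)\<^sup>[\<^sup>p\<^sup>] = a\<^sup>p Z\<^sup>[\<^sup>p\<^sup>] + N(a, Z)\<close>, where \<open>a\<^sup>p\<close> counts as a
  constant. It is stated for an arbitrary derivation of the Lie--Rinehart algebra, so that it can be
  integrated over power series, with \<open>d/dt\<close> as the derivation.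
\<close>

lemma derivation_hochschild_term:
  assumes p: "prime p" "of_nat p = (0::'k)" "odd p"
    and dA_add: "\<And>a b. dA (a + b) = dA a + dA b"
    and dA: "\<And>X b. dA (anchor X b) = anchor (dL X) b + anchor X (dA b)"
    and dL: "\<And>a X. dL (smul a X) = smul (dA a) X + smul a (dL X)"
  shows "(bracket (smul a Z) ^^ (p - 1)) (dL (smul a Z)) =
    dL (hochschild_term p a Z) + smul (a ^ p) ((bracket Z ^^ (p - 1)) (dL Z))"
proof -
  interpret Z: module_derivation smul "anchor Z" "bracket Z" by (rule anchor_module_derivation)
  let ?T = "\<lambda>X. smul a (bracket Z X)" and ?E = "anchor (smul a Z)" and ?u = "smul a Z"
  have E: "?E = (\<lambda>b. a * anchor Z b)" by (rule ext) (simp add: anchor_smult)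
  have T_add: "(?T ^^ n) (X + Y) = (?T ^^ n) X + (?T ^^ n) Y" for n X Y
    by (induction n) (simp_all add: bracket_add_right M.scale_right_distrib)
  let ?s = "\<Sum>j<p - 1. (?E ^^ (p - 1 - 1 - j)) (anchor (dL ?u) ((?E ^^ j) a))"
  have "(bracket ?u ^^ (p - 1)) (dL ?u) = (?T ^^ (p - 1)) (dL ?u) + smul ?s Z"
    unfolding ad_smult_power[where n = "p - 1"] rep.sum_rho_ad_power_pred_prime[OF p(1,2)] by simp
  also have "(?T ^^ (p - 1)) (dL ?u) = smul ((?E ^^ (p - 1)) (dA a)) Z + (smul ((?E ^^ (p - 1)) a) (dL Z)
       + smul (a ^ p) ((bracket Z ^^ (p - 1)) (dL Z)))"
    unfolding dL T_add scaled_bracket_power_self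
    using Z.hochschild[OF p(1) of_nat_char_A[OF p(2)], of a "dL Z"] by (simp add: E)
  finally show ?thesis
    unfolding hochschild_term_def dL rep.derivation_rho_power[of dA dL, OF dA_add dA]
    by (simp add: M.scale_left_distrib add_ac)
qed

lemma anchor_power_prime:
  assumes "prime p" "of_nat p = (0::'k)"
  shows "anchor X (a ^ p) = 0"
proof -
  have "anchor X (a ^ Suc n) = of_nat (Suc n) * a ^ n * anchor X a" for n
    by (induction n) (simp_all add: anchor_mult algebra_simps)
  from this[of "p - 1"] show ?thesis
    using of_nat_char_A[OF assms(2)] prime_gt_0_nat[OF assms(1)] by simp
qed

end

lemma conv_times [simp]: "conv (*) f g = f * g"
  by (simp add: conv_mult)

lemma fps_comm_algebra:
  assumes "comm_algebra s"
  shows "comm_algebra (fps_scale s)"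
proof -
  interpret comm_algebra s by fact
  interpret F: vector_space "fps_scale s"
    by (rule vector_space_fps_scale) unfold_locales
  show ?thesis
    by unfold_locales (auto intro!: fps_ext simp: fps_mult_nth scale_sum_right scale_mult_left)
qed

lemma fps_module:
  assumes "module smul"
  shows "module (conv smul)"
proof -
  interpret module smul by fact
  interpret B: biadditive smul
    by unfold_locales (simp_all add: scale_left_distrib scale_right_distrib)
  interpret T: biadditive "(*) :: 'a \<Rightarrow> 'a \<Rightarrow> 'a"
    by unfold_locales (simp_all add: algebra_simps)
  show ?thesis
  proof
    fix a b :: "'a fps" and x y :: "'b fps"
    show "conv smul a (x + y) = conv smul a x + conv smul a y" by (rule B.conv_add_right)
    show "conv smul (a + b) x = conv smul a x + conv smul b x" by (rule B.conv_add_left)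
    show "conv smul 1 x = x"
      by (rule fps_ext) (simp only: fps_const_1_eq_1[symmetric] B.conv_const_left scale_one)
    have "conv smul a (conv smul b x) = conv smul (conv (*) a b) x"
      by (rule fps_ext) (simp only: B.conv_conv_left B.conv_conv_right scale_scale)
    then show "conv smul a (conv smul b x) = conv smul (a * b) x" by simp
  qed
qed

text \<open>
  The second conclusion identifies the two descriptions of the scalar multiplication by \<open>k\<close> on
  \<open>L[[t]]\<close>, through \<open>A[[t]]\<close> and coefficientwise, so that the results on Lie algebras apply to it.
\<close>

lemma fps_lie_rinehart_algebra:
  fixes scale :: "'k::field \<Rightarrow> 'a::comm_ring_1 \<Rightarrow> 'a"
  assumes "lie_rinehart_algebra scale smul br anchor" and two: "(2::'k) \<noteq> 0"
  shows "lie_rinehart_algebra (fps_scale scale) (conv smul) (conv br) (conv anchor)"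
    and "restrict_scalars (fps_scale scale) (conv smul) = fps_scale (restrict_scalars scale smul)"
proof -
  interpret lie_rinehart_algebra scale smul br anchor by fact
  interpret S: biadditive smul
    by unfold_locales (simp_all add: M.scale_left_distrib M.scale_right_distrib)
  interpret T: biadditive "(*) :: 'a \<Rightarrow> 'a \<Rightarrow> 'a"
    by unfold_locales (simp_all add: algebra_simps)
  interpret R: biadditive br by (rule biadditive_bracket)
  interpret N: biadditive anchor by (rule rep.biadditive_rho)
  have const: "fps_scale scale c 1 = fps_const (scale c 1)" for c
    by (rule fps_ext) simp
  show restrict: "restrict_scalars (fps_scale scale) (conv smul) = fps_scale (restrict_scalars scale smul)"
    unfolding const by (intro ext fps_ext) (simp add: S.conv_const_left)
  interpret F: lie_representation "fps_scale (restrict_scalars scale smul)" "conv br" "fps_scale scale" "conv anchor"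
    by (rule fps_lie_representation[OF anchor_representation two])
  show "lie_rinehart_algebra (fps_scale scale) (conv smul) (conv br) (conv anchor)"
  proof (intro lie_rinehart_algebra.intro lie_rinehart_algebra_axioms.intro)
    show "comm_algebra (fps_scale scale)" by (rule fps_comm_algebra) unfold_locales
    show "module (conv smul)" by (rule fps_module) unfold_locales
    show "lie_algebra (restrict_scalars (fps_scale scale) (conv smul)) (conv br)"
      unfolding restrict by unfold_locales
    fix X Y :: "'b fps" and a b :: "'a fps"
    show "conv anchor (X + Y) b = conv anchor X b + conv anchor Y b"
      by (rule F.rho_add_left)
    show "conv anchor (conv br X Y) b = conv anchor X (conv anchor Y b) - conv anchor Y (conv anchor X b)"
      by (rule F.rho_bracket)
    have "conv anchor (conv smul a X) b = conv (*) a (conv anchor X b)"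
      by (rule fps_ext) (simp only: N.conv_conv_left T.conv_conv_right anchor_smult)
    then show "conv anchor (conv smul a X) b = a * conv anchor X b" by simp
    show "conv br X (conv smul a Y) = conv smul a (conv br X Y) + conv smul (conv anchor X a) Y"
    proof (rule fps_ext)
      fix n
      have swap: "conv smul a (conv br X Y) $ n = (\<Sum>(i,j,k)\<in>triples n. smul (a $ j) (br (X $ i) (Y $ k)))"
        unfolding S.conv_conv_right by (rule sum_triples_swap)
      show "conv br X (conv smul a Y) $ n = (conv smul a (conv br X Y) + conv smul (conv anchor X a) Y) $ n"
        unfolding fps_add_nth swap R.conv_conv_right S.conv_conv_left sum.distrib[symmetric]
        by (rule sum.cong) (auto simp: bracket_smult)
    qed
    have prod: "conv anchor X (a * b) = a * conv anchor X b + conv anchor X a * b" for a b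
    proof (rule fps_ext)
      fix n
      have swap: "conv (*) a (conv anchor X b) $ n = (\<Sum>(i,j,k)\<in>triples n. a $ j * anchor (X $ i) (b $ k))"
        unfolding T.conv_conv_right by (rule sum_triples_swap)
      have "conv anchor X (conv (*) a b) $ n = (conv (*) a (conv anchor X b) + conv (*) (conv anchor X a) b) $ n"
        unfolding fps_add_nth swap N.conv_conv_right T.conv_conv_left sum.distrib[symmetric]
        by (rule sum.cong) (auto simp: anchor_mult)
      then show "conv anchor X (a * b) $ n = (a * conv anchor X b + conv anchor X a * b) $ n" by simp
    qed
    interpret FA: vector_space "fps_scale scale" by (rule F.V.vector_space_axioms)
    show "derivation (fps_scale scale) (conv anchor X)"
      by unfold_locales (simp_all add: F.rho_add_right F.rho_scale_right prod)
  qed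
qed

lemma conv_const_line:
  assumes "biadditive B"
  shows "conv B (fps_const a) (line x y) = line (B a x) (B a y)"
proof -
  interpret biadditive B by fact
  show ?thesis by (rule fps_ext) (simp add: conv_const_left line_nth)
qed

lemma conv_line_const:
  assumes "biadditive B"
  shows "conv B (line x y) (fps_const a) = line (B x a) (B y a)"
proof -
  interpret biadditive B by fact
  interpret F: biadditive "\<lambda>y x. B x y" by unfold_locales (simp_all add: add_left add_right)
  show ?thesis by (subst conv_flip, rule fps_ext) (simp add: F.conv_const_left line_nth)
qed

context lie_rinehart_algebra
begin

lemma biadditive_smul: "biadditive smul"
  by unfold_locales (simp_all add: M.scale_left_distrib M.scale_right_distrib)

text \<open>
  One of \<open>w\<close> and \<open>z\<close> is constant and the other is linear in \<open>t\<close>. The two cases give the two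
  identities for \<open>\<Lambda>\<close> below.
\<close>

lemma hochschild_term_polynomial:
  assumes p: "prime p" "of_nat p = (0::'k)" "odd p"
    and w: "interpolates m w a b c" and z: "interpolates n z X Y Z" and mn: "m + n = 1"
  defines "u \<equiv> conv smul w z"
  shows "Int01 p (restrict_scalars scale smul)
      ((conv bracket u ^^ (p - 1)) (fps_diff (restrict_scalars scale smul) u)
      - conv smul (w ^ p) ((conv bracket z ^^ (p - 1)) (fps_diff (restrict_scalars scale smul) z)))
    = hochschild_term p c Z - hochschild_term p a X - hochschild_term p b Y"
proof -
  note two = odd_prime_two_neq_0[OF p]
  interpret S: biadditive smul by (rule biadditive_smul)
  note F = fps_lie_rinehart_algebra[OF lie_rinehart_algebra_axioms two]
  interpret F: lie_rinehart_algebra "fps_scale scale" "conv smul" "conv bracket" "conv anchor"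
    by (rule F(1))
  have N: "biadditive anchor" by (rule rep.biadditive_rho)
  let ?dL = "fps_diff (restrict_scalars scale smul)" and ?dA = "fps_diff scale"
  have vA: "vector_space scale" by (rule A.vector_space_axioms)
  have vL: "vector_space (restrict_scalars scale smul)" by (rule vector_space_axioms)
  have "(conv bracket u ^^ (p - 1)) (?dL u) =
      ?dL (F.hochschild_term p w z) + conv smul (w ^ p) ((conv bracket z ^^ (p - 1)) (?dL z))"
    unfolding u_def
  proof (rule F.derivation_hochschild_term[OF p, of ?dA])
    show "?dA (f + g) = ?dA f + ?dA g" for f g by (rule fps_diff_add[OF vA])
    show "?dA (conv anchor f g) = conv anchor (?dL f) g + conv anchor f (?dA g)" for f g
      by (rule rep.fps_diff_conv_rho)
    show "?dL (conv smul f g) = conv smul (?dA f) g + conv smul f (?dL g)" for f g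
      by (rule S.fps_diff_conv[OF vL]) (simp_all add: A.scale_mult_left[symmetric] mult.commute[of _ "scale c 1" for c])
  qed
  moreover have "interpolates p (F.hochschild_term p w z)
      (hochschild_term p a X) (hochschild_term p b Y) (hochschild_term p c Z)"
  proof -
    have u: "interpolates 1 u (smul a X) (smul b Y) (smul c Z)"
      unfolding u_def mn[symmetric] by (rule S.interpolates_conv[OF w z])
    have "p - 1 + m + n = p" using mn prime_gt_0_nat[OF p(1)] by simp
    then show ?thesis
      using S.interpolates_conv[OF interpolates_funpow[OF N u w, where n = "p - 1"] z]
      by (simp add: F.hochschild_term_def hochschild_term_def u_def)
  qed
  ultimately show ?thesis
    by (simp add: Int01_fps_diff[OF vL p(1,2)] diff_diff_eq)
qed

lemma jacobson_Lambda_smult_coeff: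
  assumes p: "prime p" "of_nat p = (0::'k)" "odd p"
  shows "jacobson_Lambda p (restrict_scalars scale smul) bracket (smul x Z) (smul y Z) =
    hochschild_term p (x + y) Z - hochschild_term p x Z - hochschild_term p y Z"
proof -
  interpret F: lie_rinehart_algebra "fps_scale scale" "conv smul" "conv bracket" "conv anchor"
    by (rule fps_lie_rinehart_algebra(1)[OF lie_rinehart_algebra_axioms odd_prime_two_neq_0[OF p]])
  let ?W = "\<lambda>u. (conv bracket u ^^ (p - 1))"
  have 0: "(conv bracket u ^^ n) 0 = 0" for u n
    by (induction n) (simp_all add: biadditive.zero_right[OF F.biadditive_bracket])
  have d: "fps_diff (restrict_scalars scale smul) (line X Y) = fps_const X" for X Y
    by (rule fps_diff_line[OF vector_space_axioms])
  have "jacobson_Lambda p (restrict_scalars scale smul) bracket (smul x Z) (smul y Z) =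
     Int01 p (restrict_scalars scale smul) (?W (line (smul x Z) (smul y Z)) (fps_const (smul x Z)))"
    by (rule jacobson_Lambda_eq_Int01) unfold_locales
  then show ?thesis
    using hochschild_term_polynomial[OF p interpolates_line[of x y] interpolates_const[of Z]]
    by (simp add: conv_line_const[OF biadditive_smul] fps_diff_fps_const[OF vector_space_axioms] d 0
      F.M.scale_zero_right diff_diff_eq add.commute)
qed

lemma jacobson_Lambda_smult:
  assumes p: "prime p" "of_nat p = (0::'k)" "odd p"
  shows "jacobson_Lambda p (restrict_scalars scale smul) bracket (smul a X) (smul a Y) =
    smul (a ^ p) (jacobson_Lambda p (restrict_scalars scale smul) bracket X Y)
    + hochschild_term p a (X + Y) - hochschild_term p a X - hochschild_term p a Y"
proof -
  interpret S: biadditive smul by (rule biadditive_smul)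
  let ?W = "\<lambda>u. (conv bracket u ^^ (p - 1))" and ?I = "Int01 p (restrict_scalars scale smul)"
  let ?L = "jacobson_Lambda p (restrict_scalars scale smul) bracket"
  have d: "fps_diff (restrict_scalars scale smul) (line X Y) = fps_const X" for X Y
    by (rule fps_diff_line[OF vector_space_axioms])
  have L: "?L X Y = ?I (?W (line X Y) (fps_const X))" for X Y
    by (rule jacobson_Lambda_eq_Int01) unfold_locales
  have I_diff: "?I (f - g) = ?I f - ?I g" for f g
    by (simp add: Int01_def M.scale_right_diff_distrib sum_subtractf)
  have I_smul: "?I (conv smul (fps_const b) f) = smul b (?I f)" for b f
    by (simp add: Int01_def S.conv_const_left M.scale_sum_right mult.commute)
  have "?L (smul a X) (smul a Y) - smul (a ^ p) (?L X Y) =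
      hochschild_term p a (X + Y) - hochschild_term p a Y - hochschild_term p a X"
    using hochschild_term_polynomial[OF p interpolates_const[of a] interpolates_line[of X Y]]
    by (simp add: conv_const_line[OF biadditive_smul] d L I_diff I_smul)
  then show ?thesis by (simp add: algebra_simps)
qed

end


section \<open>Additive maps out of the Kaehler differentials\<close>

context comm_monoid_set
begin

text \<open>
  A function \<open>\<phi> x u\<close> that is additive in \<open>x\<close> extends to formal sums of symbols \<open>x du\<close>, with values in
  any commutative monoid.
\<close>

lemma F_lookup_superset:
  assumes "\<And>u. \<phi> 0 u = \<^bold>1" "finite S" "Poly_Mapping.keys p \<subseteq> S"
  shows "F (\<lambda>u. \<phi> (Poly_Mapping.lookup p u) u) (Poly_Mapping.keys p) = F (\<lambda>u. \<phi> (Poly_Mapping.lookup p u) u) S"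
  by (rule mono_neutral_left) (use assms in \<open>auto simp: in_keys_iff\<close>)

lemma F_lookup_add:
  assumes "\<And>u. \<phi> 0 u = \<^bold>1" "\<And>x y u. \<phi> (x + y) u = \<phi> x u \<^bold>* \<phi> y u"
  shows "F (\<lambda>u. \<phi> (Poly_Mapping.lookup (p + q) u) u) (Poly_Mapping.keys (p + q)) =
    F (\<lambda>u. \<phi> (Poly_Mapping.lookup p u) u) (Poly_Mapping.keys p) \<^bold>*
    F (\<lambda>u. \<phi> (Poly_Mapping.lookup q u) u) (Poly_Mapping.keys q)"
proof -
  let ?S = "Poly_Mapping.keys p \<union> Poly_Mapping.keys q"
  have S: "finite ?S" "Poly_Mapping.keys (p + q) \<subseteq> ?S" "Poly_Mapping.keys p \<subseteq> ?S" "Poly_Mapping.keys q \<subseteq> ?S"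
    by (auto simp: keys_add)
  show ?thesis
    unfolding F_lookup_superset[of \<phi>, OF assms(1) S(1,2)] F_lookup_superset[of \<phi>, OF assms(1) S(1,3)]
      F_lookup_superset[of \<phi>, OF assms(1) S(1,4)]
    by (simp add: lookup_add assms(2) distrib)
qed

lemma F_lookup_single:
  assumes "\<And>u. \<phi> 0 u = \<^bold>1"
  shows "F (\<lambda>v. \<phi> (Poly_Mapping.lookup (Poly_Mapping.single u x) v) v) (Poly_Mapping.keys (Poly_Mapping.single u x)) = \<phi> x u"
  by (subst F_lookup_superset[of \<phi> "{u}", OF assms]) auto

end

lemma symbol_scale_single: "symbol_scale c (Poly_Mapping.single u x) = Poly_Mapping.single u (c * x)"
  by (rule poly_mapping_eqI)
     (simp add: symbol_scale_def Poly_Mapping.map.rep_eq lookup_single when_def)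

context kaehler_differentials
begin

lemma symbol_eval_add: "symbol_eval smul d (f + g) = symbol_eval smul d f + symbol_eval smul d g"
  unfolding symbol_eval_def
  by (rule sum.F_lookup_add[where \<phi> = "\<lambda>x u. smul x (d u)"]) (simp_all add: M.scale_left_distrib)

lemma symbol_eval_single: "symbol_eval smul d (Poly_Mapping.single u x) = smul x (d u)"
  unfolding symbol_eval_def
  by (rule sum.F_lookup_single[where \<phi> = "\<lambda>x u. smul x (d u)"]) simp

lemma symbol_eval_diff: "symbol_eval smul d (f - g) = symbol_eval smul d f - symbol_eval smul d g"
  using symbol_eval_add[of "f - g" g] by simp

lemma symbol_eval_relation: "f \<in> kaehler_relations scale \<Longrightarrow> symbol_eval smul d f = 0"
  using symbol_eval_eq_0_iff symbol_module.span_base by blast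

lemma d_add: "d (u + v) = d u + d v"
proof -
  have "symbol_eval smul d (Poly_Mapping.single (u + v) 1 - Poly_Mapping.single u 1 - Poly_Mapping.single v 1) = 0"
    by (rule symbol_eval_relation) (auto simp: kaehler_relations_def)
  then show ?thesis by (simp add: symbol_eval_diff symbol_eval_add symbol_eval_single algebra_simps)
qed

lemma d_scale: "d (scale c u) = smul (scale c 1) (d u)"
proof -
  have "symbol_eval smul d (Poly_Mapping.single (scale c u) 1 - Poly_Mapping.single u (scale c 1)) = 0"
    by (rule symbol_eval_relation) (auto simp: kaehler_relations_def)
  then show ?thesis by (simp add: symbol_eval_diff symbol_eval_single)
qed

lemma d_mult: "d (u * v) = smul u (d v) + smul v (d u)"
proof -
  have "symbol_eval smul d (Poly_Mapping.single (u * v) 1 - Poly_Mapping.single v u - Poly_Mapping.single u v) = 0"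
    by (rule symbol_eval_relation) (auto simp: kaehler_relations_def)
  then show ?thesis by (simp add: symbol_eval_diff symbol_eval_add symbol_eval_single algebra_simps)
qed

lemma d_0: "d 0 = 0"
  using d_add[of 0 0] by simp

lemma d_diff: "d (u - v) = d u - d v"
  using d_add[of "u - v" v] by simp

lemma d_minus: "d (- u) = - d u"
  using d_diff[of 0 u] by (simp add: d_0)

lemma kaehler_induct [case_names generator add]:
  assumes "\<And>x u. P (smul x (d u))" "\<And>X Y. P X \<Longrightarrow> P Y \<Longrightarrow> P (X + Y)"
  shows "P X"
proof -
  obtain f where f: "X = symbol_eval smul d f" using surj_symbol_eval by (metis surjD)
  have "P 0" using assms(1)[of 0 0] by simp
  then have "P (\<Sum>u\<in>S. smul (Poly_Mapping.lookup f u) (d u))" for S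
    by (induction S rule: infinite_finite_induct) (simp_all add: assms)
  then show ?thesis unfolding f symbol_eval_def .
qed

text \<open>
  The elements \<open>x du\<close> generate \<open>\<Omega>\<close> as an additive group, with the relations listed here. The target
  is only a monoid, given by its operation, so that the extension of \<open>\<Omega>\<close> by a cocycle can be used. The
  relations are killed by a shift: if \<open>a\<close> and \<open>b\<close> have the same image, then so do \<open>a - b + g\<close> and \<open>g\<close>.
\<close>

lemma universal_additive_map:
  fixes plus' :: "'m \<Rightarrow> 'm \<Rightarrow> 'm"
  assumes "comm_monoid plus' zero'"
    and zero: "\<And>u. \<phi> 0 u = zero'"
    and add_left: "\<And>x y u. \<phi> (x + y) u = plus' (\<phi> x u) (\<phi> y u)"
    and add_right: "\<And>x u v. \<phi> x (u + v) = plus' (\<phi> x u) (\<phi> x v)"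
    and scl: "\<And>x c u. \<phi> x (scale c u) = \<phi> (scale c x) u"
    and mult: "\<And>x u v. \<phi> x (u * v) = plus' (\<phi> (x * u) v) (\<phi> (x * v) u)"
  shows "\<exists>\<Phi>. (\<forall>X Y. \<Phi> (X + Y) = plus' (\<Phi> X) (\<Phi> Y)) \<and> (\<forall>x u. \<Phi> (smul x (d u)) = \<phi> x u)"
proof -
  interpret comm_monoid plus' zero' by fact
  interpret S: comm_monoid_set plus' zero' by (rule comm_monoid_set.intro) fact
  define \<Psi> where "\<Psi> f = S.F (\<lambda>u. \<phi> (Poly_Mapping.lookup f u) u) (Poly_Mapping.keys f)" for f
  have \<Psi>_add: "\<Psi> (f + g) = plus' (\<Psi> f) (\<Psi> g)" for f g
    unfolding \<Psi>_def by (rule S.F_lookup_add[where \<phi> = \<phi>, OF zero add_left])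
  have \<Psi>_single: "\<Psi> (Poly_Mapping.single u x) = \<phi> x u" for u x
    unfolding \<Psi>_def by (rule S.F_lookup_single[where \<phi> = \<phi>, OF zero])
  have shift: "\<Psi> (a - b + g) = \<Psi> g" if "\<Psi> a = \<Psi> b" for a b g
  proof -
    have "\<Psi> (a - b + g) = \<Psi> (a + (g - b))" by (simp add: algebra_simps)
    also have "\<dots> = \<Psi> (b + (g - b))" by (simp only: \<Psi>_add that)
    finally show ?thesis by simp
  qed
  have rel: "\<Psi> (symbol_scale c r + g) = \<Psi> g" if "r \<in> kaehler_relations scale" for c r g
    using that unfolding kaehler_relations_def
  proof (elim UnE CollectE exE conjE)
    fix u v assume r: "r = Poly_Mapping.single (u + v) 1 - Poly_Mapping.single u 1 - Poly_Mapping.single v 1"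
    have eq: "symbol_scale c r = Poly_Mapping.single (u + v) c - (Poly_Mapping.single u c + Poly_Mapping.single v c)"
      by (simp add: r symbol_module.scale_right_diff_distrib symbol_scale_single)
    show ?thesis unfolding eq by (rule shift) (simp only: \<Psi>_add \<Psi>_single add_right)
  next
    fix k u assume r: "r = Poly_Mapping.single (scale k u) 1 - Poly_Mapping.single u (scale k 1)"
    have eq: "symbol_scale c r = Poly_Mapping.single (scale k u) c - Poly_Mapping.single u (scale k c)"
      using A.scale_mult_left[of k 1 c]
      by (simp add: r symbol_module.scale_right_diff_distrib symbol_scale_single mult.commute)
    show ?thesis unfolding eq by (rule shift) (simp only: \<Psi>_single scl)
  next
    fix u v assume r: "r = Poly_Mapping.single (u * v) 1 - Poly_Mapping.single v u - Poly_Mapping.single u v"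
    have eq: "symbol_scale c r = Poly_Mapping.single (u * v) c - (Poly_Mapping.single v (c * u) + Poly_Mapping.single u (c * v))"
      by (simp add: r symbol_module.scale_right_diff_distrib symbol_scale_single)
    show ?thesis unfolding eq by (rule shift) (simp only: \<Psi>_add \<Psi>_single mult)
  qed
  have span: "\<Psi> (r + g) = \<Psi> g" if "r \<in> symbol_module.span (kaehler_relations scale)" for r g
    using that
  proof (induction arbitrary: g rule: symbol_module.span_induct_alt)
    case (step c x y)
    then show ?case using rel[of x c "y + g"] by (simp add: add.assoc)
  qed simp
  define \<Phi> where "\<Phi> X = \<Psi> (SOME f. symbol_eval smul d f = X)" for X
  have \<Phi>: "\<Phi> (symbol_eval smul d f) = \<Psi> f" for f
  proof -
    define g where "g = (SOME g. symbol_eval smul d g = symbol_eval smul d f)"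
    have "symbol_eval smul d g = symbol_eval smul d f" unfolding g_def by (rule someI) simp
    then have "symbol_eval smul d (g - f) = 0" by (simp add: symbol_eval_diff)
    then have "\<Psi> (g - f + f) = \<Psi> f" by (intro span) (simp add: symbol_eval_eq_0_iff)
    then show ?thesis by (simp add: \<Phi>_def g_def)
  qed
  have "\<Phi> (X + Y) = plus' (\<Phi> X) (\<Phi> Y)" for X Y
  proof -
    obtain f g where "X = symbol_eval smul d f" "Y = symbol_eval smul d g"
      using surj_symbol_eval by (metis surjD)
    then show ?thesis by (simp add: symbol_eval_add[symmetric] \<Phi> \<Psi>_add)
  qed
  moreover have "\<Phi> (smul x (d u)) = \<phi> x u" for x u
    using \<Phi>[of "Poly_Mapping.single u x"] by (simp add: symbol_eval_single \<Psi>_single)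
  ultimately show ?thesis by blast
qed

end


section \<open>The Lie--Rinehart algebra of Kaehler differentials\<close>

locale poisson_kaehler = P: poisson_algebra scale poisson + kaehler_differentials scale smul d
  for scale :: "'k::field \<Rightarrow> 'a::comm_ring_1 \<Rightarrow> 'a"
    and poisson :: "'a \<Rightarrow> 'a \<Rightarrow> 'a"
    and smul :: "'a \<Rightarrow> 'o::ab_group_add \<Rightarrow> 'o"
    and d :: "'a \<Rightarrow> 'o"
begin

abbreviation "anch \<equiv> kaehler_anchor smul d poisson"
abbreviation "brk \<equiv> kaehler_bracket smul d poisson"

lemma leibniz_right: "poisson u (x * y) = x * poisson u y + y * poisson u x"
  using P.leibniz[of x y u]
  by (simp add: P.bracket_antisym[of "x * y" u] P.bracket_antisym[of x u] P.bracket_antisym[of y u] algebra_simps)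

lemma poisson_poisson: "poisson (poisson u v) w = poisson u (poisson v w) - poisson v (poisson u w)"
  using lie_representation.rho_bracket[OF P.adjoint_representation] .

lemma scale_mult: "scale c x * y = scale c (x * y)" "x * scale c y = scale c (x * y)"
  using P.scale_mult_left[of c x y] P.scale_mult_left[of c y x] by (simp_all add: mult.commute)

lemma ex_anchor:
  "\<exists>\<alpha>. (\<forall>X Y z. \<alpha> (X + Y) z = \<alpha> X z + \<alpha> Y z) \<and> (\<forall>x u z. \<alpha> (smul x (d u)) z = x * poisson u z)"
proof -
  have "\<exists>\<Phi>. (\<forall>X Y. \<Phi> (X + Y) = \<Phi> X + \<Phi> Y) \<and> (\<forall>x u. \<Phi> (smul x (d u)) = x * poisson u z)" for z
    by (rule universal_additive_map)
       (simp_all add: add.comm_monoid_axioms P.bracket_add_left P.bracket_scale_left P.leibniz scale_mult algebra_simps)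
  then have "\<exists>\<Phi>. \<forall>z. (\<forall>X Y. \<Phi> z (X + Y) = \<Phi> z X + \<Phi> z Y) \<and> (\<forall>x u. \<Phi> z (smul x (d u)) = x * poisson u z)"
    by (intro choice) blast
  then obtain \<Phi> where "\<forall>z. (\<forall>X Y. \<Phi> z (X + Y) = \<Phi> z X + \<Phi> z Y) \<and> (\<forall>x u. \<Phi> z (smul x (d u)) = x * poisson u z)" ..
  then show ?thesis by (intro exI[of _ "\<lambda>X z. \<Phi> z X"]) blast
qed

lemma anch_char:
  "(\<forall>X Y z. anch (X + Y) z = anch X z + anch Y z) \<and> (\<forall>x u z. anch (smul x (d u)) z = x * poisson u z)"
proof -
  obtain \<beta> where \<beta>: "(\<forall>X Y z. \<beta> (X + Y) z = \<beta> X z + \<beta> Y z) \<and> (\<forall>x u z. \<beta> (smul x (d u)) z = x * poisson u z)"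
    using ex_anchor by blast
  have "anch = \<beta>"
    unfolding kaehler_anchor_def
  proof (rule the_equality, rule \<beta>)
    fix \<alpha> :: "'o \<Rightarrow> 'a \<Rightarrow> 'a"
    assume \<alpha>: "(\<forall>X Y z. \<alpha> (X + Y) z = \<alpha> X z + \<alpha> Y z) \<and> (\<forall>x u z. \<alpha> (smul x (d u)) z = x * poisson u z)"
    have "\<alpha> X z = \<beta> X z" for X z
      by (induction X rule: kaehler_induct) (simp_all add: \<alpha> \<beta>)
    then show "\<alpha> = \<beta>" by blast
  qed
  with \<beta> show ?thesis by simp
qed

lemma anch_add: "anch (X + Y) z = anch X z + anch Y z"
  and anch_generator: "anch (smul x (d u)) z = x * poisson u z"
  using anch_char by blast+

lemma anch_add_right: "anch X (a + b) = anch X a + anch X b"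
  by (induction X rule: kaehler_induct) (simp_all add: anch_generator anch_add P.bracket_add_right algebra_simps)

lemma anch_scale_right: "anch X (scale c a) = scale c (anch X a)"
  by (induction X rule: kaehler_induct)
     (simp_all add: anch_generator anch_add P.bracket_scale_right scale_mult P.scale_right_distrib)

lemma anch_mult: "anch X (a * b) = a * anch X b + anch X a * b"
  by (induction X rule: kaehler_induct)
     (simp_all add: anch_generator anch_add leibniz_right algebra_simps)

lemma anch_smul: "anch (smul a X) b = a * anch X b"
  by (induction X rule: kaehler_induct)
     (simp_all add: anch_generator anch_add M.scale_right_distrib algebra_simps)

text \<open>
  The Lie derivative along the Hamiltonian derivation \<open>{u, -}\<close>; it will be the bracket with \<open>du\<close>.
\<close>

lemma ex_lie_derivative:
  "\<exists>L. (\<forall>u X Y. L u (X + Y) = L u X + L u Y) \<and>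
     (\<forall>u y v. L u (smul y (d v)) = smul (poisson u y) (d v) + smul y (d (poisson u v)))"
proof -
  have "\<exists>\<Phi>. (\<forall>X Y. \<Phi> (X + Y) = \<Phi> X + \<Phi> Y) \<and>
     (\<forall>y v. \<Phi> (smul y (d v)) = smul (poisson u y) (d v) + smul y (d (poisson u v)))" for u
  proof (rule universal_additive_map)
    show "comm_monoid (+) (0::'o)" by (rule add.comm_monoid_axioms)
    have "poisson u 0 = 0" using P.bracket_add_right[of u 0 0] by simp
    then show "smul (poisson u 0) (d v) + smul 0 (d (poisson u v)) = 0" for v by simp
    show "smul (poisson u x) (d (scale c v)) + smul x (d (poisson u (scale c v))) =
      smul (poisson u (scale c x)) (d v) + smul (scale c x) (d (poisson u v))" for x c v
      by (simp add: P.bracket_scale_right d_scale scale_mult)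
  qed (simp_all add: P.bracket_add_right leibniz_right d_add d_mult M.scale_left_distrib M.scale_right_distrib algebra_simps)
  then have "\<forall>u. \<exists>\<Phi>. (\<forall>X Y. \<Phi> (X + Y) = \<Phi> X + \<Phi> Y) \<and>
     (\<forall>y v. \<Phi> (smul y (d v)) = smul (poisson u y) (d v) + smul y (d (poisson u v)))" by blast
  from choice[OF this] show ?thesis by blast
qed

text \<open>
  For fixed \<open>Y\<close>, the bracket is obtained as the additive map \<open>x du \<mapsto> x L\<^sub>u(Y) - Y(x) du\<close> in the first
  argument, where \<open>L\<^sub>u\<close> is the Lie derivative.
\<close>

lemma ex_bracket:
  "\<exists>b. (\<forall>X Y Z. b (X + Y) Z = b X Z + b Y Z) \<and>
     (\<forall>X Y Z. b X (Y + Z) = b X Y + b X Z) \<and>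
     (\<forall>x u y v. b (smul x (d u)) (smul y (d v)) =
        smul (x * poisson u y) (d v) + smul (y * poisson x v) (d u)
        + smul (x * y) (d (poisson u v)))"
proof -
  obtain L where L_add: "\<And>u X Y. L u (X + Y) = L u X + L u Y"
    and L_gen: "\<And>u y v. L u (smul y (d v)) = smul (poisson u y) (d v) + smul y (d (poisson u v))"
    using ex_lie_derivative by blast
  have L_sum: "L (u + v) Y = L u Y + L v Y" for u v Y
    by (induction Y rule: kaehler_induct)
       (simp_all add: L_add L_gen P.bracket_add_left d_add M.scale_left_distrib M.scale_right_distrib algebra_simps)
  have L_scale: "L (scale c u) Y = smul (scale c 1) (L u Y)" for c u Y
    by (induction Y rule: kaehler_induct)
       (simp_all add: L_add L_gen P.bracket_scale_left d_scale M.scale_right_distrib scale_mult)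
  have L_mult: "L (u * v) Y = smul u (L v Y) + smul v (L u Y) - smul (anch Y u) (d v) - smul (anch Y v) (d u)" for u v Y
  proof (induction Y rule: kaehler_induct)
    case (generator y w)
    show ?case
      by (simp add: L_gen anch_generator P.leibniz d_add d_minus d_diff d_mult M.scale_left_distrib M.scale_right_distrib
          P.bracket_antisym[of u w] P.bracket_antisym[of v w] algebra_simps)
  qed (simp add: L_add anch_add M.scale_left_distrib M.scale_right_distrib algebra_simps)
  have "\<exists>\<Phi>. (\<forall>X X'. \<Phi> (X + X') = \<Phi> X + \<Phi> X') \<and>
     (\<forall>x u. \<Phi> (smul x (d u)) = smul x (L u Y) - smul (anch Y x) (d u))" for Y
  proof (rule universal_additive_map)
    show "comm_monoid (+) (0::'o)" by (rule add.comm_monoid_axioms)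
    have "anch Y 0 = 0" using anch_add_right[of Y 0 0] by simp
    then show "smul 0 (L u Y) - smul (anch Y 0) (d u) = 0" for u by simp
  qed (simp_all add: L_sum L_scale L_mult anch_add_right anch_mult anch_scale_right d_add d_scale d_mult scale_mult
        M.scale_left_distrib M.scale_right_distrib M.scale_right_diff_distrib algebra_simps)
  then have "\<forall>Y. \<exists>\<Phi>. (\<forall>X X'. \<Phi> (X + X') = \<Phi> X + \<Phi> X') \<and>
     (\<forall>x u. \<Phi> (smul x (d u)) = smul x (L u Y) - smul (anch Y x) (d u))" by blast
  from choice[OF this] obtain B where B_add: "\<And>X X' Y. B Y (X + X') = B Y X + B Y X'"
    and B_gen: "\<And>Y x u. B Y (smul x (d u)) = smul x (L u Y) - smul (anch Y x) (d u)" by blast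
  have "B (Y + Z) X = B Y X + B Z X" for X Y Z
    by (induction X rule: kaehler_induct)
       (simp_all add: B_add B_gen L_add anch_add M.scale_left_distrib M.scale_right_distrib algebra_simps)
  moreover have "B (smul y (d v)) (smul x (d u)) =
        smul (x * poisson u y) (d v) + smul (y * poisson x v) (d u) + smul (x * y) (d (poisson u v))" for x u y v
    by (simp add: B_gen L_gen anch_generator P.bracket_antisym[of x v] M.scale_right_distrib algebra_simps)
  ultimately show ?thesis using B_add by (intro exI[of _ "\<lambda>X Y. B Y X"]) blast
qed

lemma brk_char:
  "(\<forall>X Y Z. brk (X + Y) Z = brk X Z + brk Y Z) \<and>
   (\<forall>X Y Z. brk X (Y + Z) = brk X Y + brk X Z) \<and>
   (\<forall>x u y v. brk (smul x (d u)) (smul y (d v)) =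
      smul (x * poisson u y) (d v) + smul (y * poisson x v) (d u) + smul (x * y) (d (poisson u v)))"
proof -
  obtain b where b: "(\<forall>X Y Z. b (X + Y) Z = b X Z + b Y Z) \<and>
     (\<forall>X Y Z. b X (Y + Z) = b X Y + b X Z) \<and>
     (\<forall>x u y v. b (smul x (d u)) (smul y (d v)) =
        smul (x * poisson u y) (d v) + smul (y * poisson x v) (d u) + smul (x * y) (d (poisson u v)))"
    using ex_bracket by blast
  have "brk = b"
    unfolding kaehler_bracket_def
  proof (rule the_equality, rule b)
    fix c :: "'o \<Rightarrow> 'o \<Rightarrow> 'o"
    assume c: "(\<forall>X Y Z. c (X + Y) Z = c X Z + c Y Z) \<and>
     (\<forall>X Y Z. c X (Y + Z) = c X Y + c X Z) \<and>
     (\<forall>x u y v. c (smul x (d u)) (smul y (d v)) =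
        smul (x * poisson u y) (d v) + smul (y * poisson x v) (d u) + smul (x * y) (d (poisson u v)))"
    have gen: "c (smul x (d u)) Y = b (smul x (d u)) Y" for x u Y
      by (induction Y rule: kaehler_induct) (simp_all only: b c)
    have "c X Y = b X Y" for X Y
      by (induction X rule: kaehler_induct) (simp_all only: gen b c)
    then show "c = b" by blast
  qed
  with b show ?thesis by simp
qed

lemma brk_add_left: "brk (X + Y) Z = brk X Z + brk Y Z"
  and brk_add_right: "brk X (Y + Z) = brk X Y + brk X Z"
  and brk_generator: "brk (smul x (d u)) (smul y (d v)) =
      smul (x * poisson u y) (d v) + smul (y * poisson x v) (d u) + smul (x * y) (d (poisson u v))"
  using brk_char by blast+

lemma poisson_self: "poisson u u = 0"
  by (rule P.bracket_self)

lemma brk_antisym: "brk Y X = - brk X Y"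
proof -
  have gen: "brk Y (smul x (d u)) + brk (smul x (d u)) Y = 0" for x u
  proof (induction Y rule: kaehler_induct)
    case (generator y v)
    have "d (poisson v u) + d (poisson u v) = 0"
      by (simp add: d_add[symmetric] P.bracket_antisym[of v u] d_0)
    then have "smul (x * y) (d (poisson v u)) + smul (x * y) (d (poisson u v)) = 0"
      by (simp add: M.scale_right_distrib[symmetric])
    then show ?case
      by (simp add: brk_generator P.bracket_antisym[of v x] P.bracket_antisym[of y u] algebra_simps)
  next
    case (add Y Y')
    then show ?case by (simp add: brk_add_left brk_add_right algebra_simps)
  qed
  have "brk Y X + brk X Y = 0"
  proof (induction X rule: kaehler_induct)
    case (add X X')
    then show ?case by (simp add: brk_add_left brk_add_right algebra_simps)
  qed (rule gen)
  then show ?thesis by (simp add: eq_neg_iff_add_eq_0)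
qed

lemma brk_self: "brk X X = 0"
proof (induction X rule: kaehler_induct)
  case (generator x u)
  show ?case by (simp add: brk_generator P.bracket_antisym[of x u] poisson_self d_0)
next
  case (add X Y)
  then show ?case by (simp add: brk_add_left brk_add_right brk_antisym[of Y X])
qed

lemma brk_smul: "brk X (smul a Y) = smul a (brk X Y) + smul (anch X a) Y"
proof -
  have gen: "brk (smul x (d u)) (smul a Y) = smul a (brk (smul x (d u)) Y) + smul (anch (smul x (d u)) a) Y" for x u
  proof (induction Y rule: kaehler_induct)
    case (generator y v)
    show ?case
      by (simp add: brk_generator anch_generator leibniz_right M.scale_right_distrib M.scale_left_distrib algebra_simps)
  qed (simp add: brk_add_right M.scale_right_distrib algebra_simps)
  show ?thesis
  proof (induction X rule: kaehler_induct)
    case (add X X')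
    then show ?case by (simp add: brk_add_left anch_add M.scale_left_distrib M.scale_right_distrib algebra_simps)
  qed (rule gen)
qed

lemma anch_brk: "anch (brk X Y) b = anch X (anch Y b) - anch Y (anch X b)"
proof -
  have gen: "anch (brk (smul x (d u)) Y) b = anch (smul x (d u)) (anch Y b) - anch Y (anch (smul x (d u)) b)" for x u
  proof (induction Y rule: kaehler_induct)
    case (generator y v)
    show ?case
      by (simp add: brk_generator anch_add anch_generator leibniz_right poisson_poisson)
         (simp add: P.bracket_antisym[of x v] algebra_simps)
  qed (simp add: brk_add_right anch_add anch_add_right algebra_simps)
  show ?thesis
  proof (induction X rule: kaehler_induct)
    case (add X X')
    then show ?case by (simp add: brk_add_left anch_add anch_add_right algebra_simps)
  qed (rule gen)
qed

lemma brk_minus_right: "brk X (- Y) = - brk X Y"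
  using brk_add_right[of X Y "- Y"] brk_add_right[of X 0 0] by (simp add: eq_neg_iff_add_eq_0 add.commute)

text \<open>
  The Jacobiator turns out to be \<open>A\<close>-linear in each argument, so it vanishes because it vanishes on
  the exact differentials.
\<close>

definition jacobiator :: "'o \<Rightarrow> 'o \<Rightarrow> 'o \<Rightarrow> 'o" where
  "jacobiator X Y Z = brk X (brk Y Z) + brk Y (brk Z X) + brk Z (brk X Y)"

lemma jacobiator_cyclic: "jacobiator X Y Z = jacobiator Y Z X"
  by (simp add: jacobiator_def algebra_simps)

lemma jacobiator_add: "jacobiator X Y (Z + Z') = jacobiator X Y Z + jacobiator X Y Z'"
  by (simp add: jacobiator_def brk_add_left brk_add_right algebra_simps)

lemma jacobiator_smul: "jacobiator X Y (smul a Z) = smul a (jacobiator X Y Z)"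
proof -
  have eq: "jacobiator X Y Z = brk X (brk Y Z) - brk Y (brk X Z) - brk (brk X Y) Z" for Z
    by (simp add: jacobiator_def brk_antisym[of Z X] brk_antisym[of Z "brk X Y"] brk_minus_right)
  show ?thesis
    by (simp add: eq brk_smul brk_add_right anch_brk M.scale_right_distrib M.scale_right_diff_distrib
        M.scale_left_diff_distrib algebra_simps)
qed

lemma jacobiator_d: "jacobiator (d u) (d v) (d w) = 0"
proof -
  have one: "poisson 1 u = 0" for u using P.leibniz[of 1 1 u] by simp
  have "brk (d u) (d v) = d (poisson u v)" for u v
    using brk_generator[of 1 u 1 v] by (simp add: one P.bracket_antisym[of u 1])
  then show ?thesis by (simp add: jacobiator_def d_add[symmetric] P.jacobi d_0)
qed

lemma jacobiator_eq_0: "jacobiator X Y Z = 0"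
proof -
  have 1: "jacobiator (d u) (d v) Z = 0" for u v Z
    by (induction Z rule: kaehler_induct) (simp_all add: jacobiator_smul jacobiator_d jacobiator_add)
  have rotate: "jacobiator X Y Z = jacobiator Z X Y" for X Y Z
    by (simp only: jacobiator_cyclic[of Z])
  have 2: "jacobiator (d u) Y Z = 0" for u Y Z
  proof (induction Y rule: kaehler_induct)
    case (generator y v)
    have "jacobiator Z (d u) (smul y (d v)) = smul y (jacobiator (d u) (d v) Z)"
      by (simp only: jacobiator_smul rotate[of "d u" "d v" Z])
    then show ?case by (simp add: 1 rotate[of "d u"])
  next
    case (add Y Y')
    then show ?case by (simp add: rotate[of "d u"] jacobiator_add)
  qed
  show ?thesis
  proof (induction X rule: kaehler_induct)
    case (generator x u)
    have "jacobiator (smul x (d u)) Y Z = smul x (jacobiator (d u) Y Z)"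
      by (simp only: jacobiator_smul jacobiator_cyclic[of _ Y Z])
    then show ?case by (simp add: 2)
  next
    case (add X X')
    then show ?case by (simp add: jacobiator_cyclic[of _ Y Z] jacobiator_add)
  qed
qed

lemma anch_const: "anch X (scale c 1) = 0"
  using anch_mult[of X 1 1] by (simp add: anch_scale_right)

lemma lie_rinehart: "lie_rinehart_algebra scale smul brk anch"
proof (intro lie_rinehart_algebra.intro lie_rinehart_algebra_axioms.intro)
  show "comm_algebra scale" by (rule P.comm_algebra_axioms)
  show "module smul" by (rule M.module_axioms)
  show "lie_algebra (restrict_scalars scale smul) brk"
  proof
    show "brk (smul (scale c 1) X) Y = smul (scale c 1) (brk X Y)" for c X Y
      by (simp add: brk_antisym[of "smul (scale c 1) X" Y] brk_antisym[of X Y] brk_smul anch_const)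
    show "smul (scale a 1) (smul (scale b 1) X) = smul (scale (a * b) 1) X" for a b X
      by (simp add: scale_mult mult.commute)
    show "brk X (brk Y Z) + brk Y (brk Z X) + brk Z (brk X Y) = 0" for X Y Z
      using jacobiator_eq_0[of X Y Z] by (simp add: jacobiator_def)
  qed (simp_all add: brk_add_left brk_add_right brk_smul anch_const brk_self M.scale_right_distrib
        P.scale_left_distrib M.scale_left_distrib scale_mult)
  show "derivation scale (anch X)" for X
    by unfold_locales (simp_all add: anch_add_right anch_scale_right anch_mult)
qed (rule anch_add anch_smul anch_brk brk_smul)+

end


section \<open>The \<open>p\<close>-map on the Kaehler differentials\<close>

lemma jacobson_Lambda_hom:
  assumes "lie_algebra s br" "lie_algebra s' br'"
    and add: "\<And>x y. h (x + y) = h x + h y" and scl: "\<And>c x. h (s c x) = s' c (h x)"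
    and br: "\<And>x y. h (br x y) = br' (h x) (h y)"
  shows "h (jacobson_Lambda p s br x y) = jacobson_Lambda p s' br' (h x) (h y)"
proof -
  interpret L: lie_algebra s br by fact
  interpret L': lie_algebra s' br' by fact
  have h0: "h 0 = 0" using add[of 0 0] by simp
  have hsum: "h (sum f S) = (\<Sum>i\<in>S. h (f i))" for f and S :: "nat set"
    by (induction S rule: infinite_finite_induct) (simp_all add: add h0)
  have "h (poly.coeff ((ad_pencil br x y ^^ m) [:x:]) n) = poly.coeff ((ad_pencil br' (h x) (h y) ^^ m) [:h x:]) n" for m n
  proof (induction m arbitrary: n)
    case 0
    then show ?case by (simp add: coeff_pCons h0 split: nat.splits)
  next
    case (Suc m)
    then show ?case by (simp add: L.coeff_ad_pencil L'.coeff_ad_pencil add br h0)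
  qed
  then show ?thesis by (simp add: jacobson_Lambda_def jacobson_s_def hsum scl)
qed

lemma (in module_derivation) prime_power_product_rule:
  assumes "prime p" "of_nat p = (0::'a)"
  shows "(\<delta> ^^ p) (smul a X) = smul a ((\<delta> ^^ p) X) + smul ((D ^^ p) a) X"
proof -
  have p: "0 < p" using prime_gt_0_nat[OF assms(1)] .
  have "(\<delta> ^^ p) (smul a X) =
    (\<Sum>j\<in>{0, p}. smul (of_nat (p choose j)) (smul ((D ^^ (p - j)) a) ((\<delta> ^^ j) X)))"
    unfolding leibniz_power
  proof (rule sum.mono_neutral_right)
    show "\<forall>j\<in>{..p} - {0, p}. smul (of_nat (p choose j)) (smul ((D ^^ (p - j)) a) ((\<delta> ^^ j) X)) = 0"
      by (auto simp: of_nat_prime_binomial_eq_0[OF assms] simp del: scale_scale)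
  qed auto
  then show ?thesis using p by (simp add: add.commute)
qed

text \<open>
  The extension of the additive group of \<open>L\<close> by itself that belongs to the cocycle \<open>\<Lambda>\<close>.
\<close>

lemma (in lie_algebra) jacobson_Lambda_extension:
  assumes p: "prime p" "of_nat p = (0::'k)" "odd p"
  shows "comm_monoid (\<lambda>(x, r) (y, s). (x + y, r + s + jacobson_Lambda p scale bracket x y)) (0, 0)"
proof
  fix a b c :: "'l \<times> 'l"
  obtain x r y s z t where abc: "a = (x, r)" "b = (y, s)" "c = (z, t)"
    by (metis surj_pair)
  let ?op = "\<lambda>(x, r) (y, s). (x + y, r + s + jacobson_Lambda p scale bracket x y)"
  show "?op (?op a b) c = ?op a (?op b c)"
    using jacobson_Lambda_cocycle[OF p, of x y z] by (simp add: abc algebra_simps)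
  show "?op a b = ?op b a"
    by (simp add: abc algebra_simps jacobson_Lambda_commute[OF p, of x y])
  show "?op a (0, 0) = a"
    by (simp add: abc jacobson_Lambda_0_right[OF prime_ge_2_nat[OF p(1)]])
qed

text \<open>
  Comparing both sides of the rule for squares at \<open>(u + v)\<^sup>2\<close> leaves the product rule multiplied by
  \<open>2\<close>. The factor is removed by starting from \<open>x/2\<close>.
\<close>

lemma polarised_product_rule:
  fixes scale :: "'k::field \<Rightarrow> 'a::comm_ring_1 \<Rightarrow> 'a"
  assumes "comm_algebra scale" "comm_monoid plus' zero'" and two: "(2::'k) \<noteq> 0"
    and cancel: "\<And>a b c. plus' a b = plus' a c \<Longrightarrow> b = c"
    and add_left: "\<And>x y u. \<phi> (x + y) u = plus' (\<phi> x u) (\<phi> y u)"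
    and add_right: "\<And>x u v. \<phi> x (u + v) = plus' (\<phi> x u) (\<phi> x v)"
    and scl: "\<And>x c u. \<phi> x (scale c u) = \<phi> (scale c x) u"
    and square: "\<And>x u. \<phi> x (u * u) = \<phi> (2 * x * u) u"
  shows "\<phi> x (u * v) = plus' (\<phi> (x * u) v) (\<phi> (x * v) u)"
proof -
  interpret A: comm_algebra scale by fact
  interpret S: comm_monoid plus' zero' by fact
  \<comment> \<open>the square rule at \<open>y\<close> has the factor \<open>2 * y = x\<close>\<close>
  define y where "y = scale (1/2) x"
  have y: "scale 2 y = x" "2 * y = x"
  proof -
    show 1: "scale 2 y = x" using two by (simp add: y_def)
    have "scale 2 y = scale (1 + 1) y" by simp
    also have "\<dots> = 2 * y" unfolding A.scale_left_distrib by simp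
    finally show "2 * y = x" using 1 by simp
  qed
  have uv: "scale 2 (u * v) = u * v + u * v"
  proof -
    have "scale 2 (u * v) = scale (1 + 1) (u * v)" by simp
    then show ?thesis unfolding A.scale_left_distrib by simp
  qed
  have "(u + v) * (u + v) = (u * u + v * v) + scale 2 (u * v)"
    by (simp add: uv algebra_simps)
  then have "plus' (plus' (\<phi> (x * u) u) (\<phi> (x * v) v)) (\<phi> x (u * v)) = \<phi> (x * (u + v)) (u + v)"
    by (metis add_right scl square y)
  also have "\<dots> = plus' (plus' (\<phi> (x * u) u) (\<phi> (x * v) v)) (plus' (\<phi> (x * u) v) (\<phi> (x * v) u))"
    by (simp add: distrib_left add_left add_right S.assoc S.commute S.left_commute)
  finally show ?thesis by (rule cancel)
qed

locale restricted_poisson_kaehler =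
  R: restricted_poisson_algebra p scale poisson pmap + poisson_kaehler scale poisson smul d
  for p :: nat
    and scale :: "'k::field \<Rightarrow> 'a::comm_ring_1 \<Rightarrow> 'a"
    and poisson :: "'a \<Rightarrow> 'a \<Rightarrow> 'a"
    and pmap :: "'a \<Rightarrow> 'a"
    and smul :: "'a \<Rightarrow> 'o::ab_group_add \<Rightarrow> 'o"
    and d :: "'a \<Rightarrow> 'o" +
  assumes p: "prime p" "of_nat p = (0::'k)" "odd p"
begin

sublocale LR: lie_rinehart_algebra scale smul brk anch
  by (rule lie_rinehart)

abbreviation "\<Lambda> \<equiv> jacobson_Lambda p (restrict_scalars scale smul) brk"
abbreviation "N \<equiv> LR.hochschild_term p"

lemma char_A: "of_nat p = (0::'a)"
  by (rule LR.of_nat_char_A[OF p(2)])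

lemma power_prime_add: "(x + y) ^ p = x ^ p + (y::'a) ^ p"
proof -
  have "CHAR('a) dvd p" using char_A by (simp add: of_nat_eq_0_iff_char_dvd)
  moreover have "CHAR('a) \<noteq> 1" by simp
  ultimately have "CHAR('a) = p" using p(1) by (metis prime_nat_iff)
  then show ?thesis using freshmans_dream p(1) by metis
qed

lemma two_power_prime: "(2::'a) ^ p = 2"
  using power_prime_add[of 1 1] by simp

lemma poisson_1: "poisson 1 u = 0" "poisson u 1 = 0"
  using R.leibniz[of 1 1 u] leibniz_right[of u 1 1] by simp_all

lemma anch_d: "anch (d u) = poisson u"
  using anch_generator[of 1 u] by (intro ext) simp

lemma brk_d_d: "brk (d u) (d v) = d (poisson u v)"
  using brk_generator[of 1 u 1 v] by (simp add: poisson_1)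

lemma d_jacobson_Lambda: "d (jacobson_Lambda p scale poisson u v) = \<Lambda> (d u) (d v)"
  by (rule jacobson_Lambda_hom) (unfold_locales, simp_all add: d_add d_scale brk_d_d)

lemma d_power_prime: "d (u ^ p) = 0"
proof -
  have "d (u ^ Suc n) = smul (of_nat (Suc n) * u ^ n) (d u)" for n
  proof (induction n)
    case (Suc n)
    have "d (u ^ Suc (Suc n)) = smul u (d (u ^ Suc n)) + smul (u ^ Suc n) (d u)"
      by (simp only: power_Suc[of u "Suc n"] d_mult)
    also have "\<dots> = smul (u * (of_nat (Suc n) * u ^ n) + u ^ Suc n) (d u)"
      by (simp only: Suc.IH M.scale_scale M.scale_left_distrib)
    also have "u * (of_nat (Suc n) * u ^ n) + u ^ Suc n = of_nat (Suc (Suc n)) * u ^ Suc n"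
      by (simp add: algebra_simps)
    finally show ?case .
  qed simp
  from this[of "p - 1"] show ?thesis
    using char_A prime_gt_0_nat[OF p(1)] by simp
qed

text \<open>
  Used when \<open>a\<close> is a constant, possibly \<open>0\<close>, and when \<open>a = 2u\<close>, \<open>Z = du\<close>.
\<close>

lemma N_eq_0:
  assumes "anch (smul a Z) a = 0"
  shows "N a Z = 0"
proof -
  obtain n where n: "p - 1 = Suc n"
    using prime_ge_2_nat[OF p(1)] by (cases "p - 1") auto
  have "anch X 0 = 0" for X using anch_add_right[of X 0 0] by simp
  then have "(anch (smul a Z) ^^ m) 0 = 0" for m by (induction m) simp_all
  then have "(anch (smul a Z) ^^ (p - 1)) a = 0"
    unfolding n funpow_Suc_right by (simp add: assms)
  then show ?thesis by (simp add: LR.hochschild_term_def)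
qed

text \<open>
  The prescribed value of \<open>(x du)\<^sup>[\<^sup>p\<^sup>]\<close>.
\<close>

definition generator_pmap :: "'a \<Rightarrow> 'a \<Rightarrow> 'o" where
  "generator_pmap x u = smul (x ^ p) (d (pmap u)) + N x (d u)"

lemma generator_pmap_add_left: "generator_pmap (x + y) u = generator_pmap x u + generator_pmap y u + \<Lambda> (smul x (d u)) (smul y (d u))"
  unfolding generator_pmap_def LR.jacobson_Lambda_smult_coeff[OF p]
  by (simp add: power_prime_add M.scale_left_distrib)

lemma generator_pmap_add_right: "generator_pmap x (u + v) = generator_pmap x u + generator_pmap x v + \<Lambda> (smul x (d u)) (smul x (d v))"
  unfolding generator_pmap_def LR.jacobson_Lambda_smult[OF p]
  by (simp add: R.pmap_add d_add d_jacobson_Lambda M.scale_right_distrib)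

lemma generator_pmap_scale: "generator_pmap x (scale c u) = generator_pmap (scale c x) u"
proof -
  have "N (scale c 1) (d u) = 0"
    by (rule N_eq_0) (rule anch_const)
  then have "N (scale c x) (d u) = N x (d (scale c u))"
    using LR.hochschild_term_mult[OF p(1,2), of x "scale c 1" "d u"] by (simp add: scale_mult d_scale)
  moreover have "scale c x ^ n = scale (c ^ n) (x ^ n)" for n
    by (induction n) (simp_all add: scale_mult mult.commute)
  ultimately show ?thesis
    by (simp add: generator_pmap_def R.pmap_scale d_scale scale_mult)
qed

text \<open>
  This is where the axiom \<open>(u\<^sup>2)\<^sup>{\<^sup>p\<^sup>} = 2 u\<^sup>p u\<^sup>{\<^sup>p\<^sup>}\<close> is used. The correction terms agree because the
  derivation \<open>2u du\<close> annihilates \<open>2u\<close>.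
\<close>

lemma generator_pmap_square: "generator_pmap x (u * u) = generator_pmap (2 * x * u) u"
proof -
  have two: "d (2 * w) = smul 2 (d w)" for w
    by (simp only: mult_2 d_add) (simp only: one_add_one[symmetric] M.scale_left_distrib M.scale_one)
  have du: "d (u * u) = smul (2 * u) (d u)"
    by (simp only: d_mult mult_2 M.scale_left_distrib)
  have "N (2 * u) (d u) = 0"
    by (rule N_eq_0) (simp only: anch_generator mult_2 R.bracket_add_right poisson_self add_0_left mult_zero_right)
  then have "N x (d (u * u)) = N (x * (2 * u)) (d u)"
    using LR.hochschild_term_mult[OF p(1,2), of x "2 * u" "d u"] by (simp add: du)
  moreover have "d (pmap (u * u)) = smul (2 * u ^ p) (d (pmap u))"
    using R.pmap_square[of u] by (simp add: power2_eq_square mult.assoc two d_mult[of "u ^ p"] d_power_prime)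
  moreover have "(2 * x * u) ^ p = x ^ p * (2 * u ^ p)"
    by (simp add: power_mult_distrib two_power_prime algebra_simps)
  moreover have "x * (2 * u) = 2 * x * u" by (simp add: algebra_simps)
  ultimately show ?thesis
    by (simp add: generator_pmap_def)
qed

lemma ex_pmap:
  "\<exists>P. (\<forall>X Y. P (X + Y) = P X + P Y + \<Lambda> X Y) \<and> (\<forall>x u. P (smul x (d u)) = generator_pmap x u)"
proof -
  let ?op = "\<lambda>(X, R) (Y, S). (X + Y, R + S + \<Lambda> X Y)"
  define \<phi> where "\<phi> x u = (smul x (d u), generator_pmap x u)" for x u
  have monoid: "comm_monoid ?op (0, 0)"
    by (rule LR.jacobson_Lambda_extension[OF p])
  have N0: "N 0 Z = 0" for Z
    using anch_add_right[of 0 0 0] by (intro N_eq_0) simp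
  have zero: "\<phi> 0 u = (0, 0)" for u
    using prime_gt_0_nat[OF p(1)] by (simp add: \<phi>_def generator_pmap_def N0 zero_power)
  have add_left: "\<phi> (x + y) u = ?op (\<phi> x u) (\<phi> y u)" for x y u
    by (simp add: \<phi>_def generator_pmap_add_left M.scale_left_distrib)
  have add_right: "\<phi> x (u + v) = ?op (\<phi> x u) (\<phi> x v)" for x u v
    by (simp add: \<phi>_def generator_pmap_add_right d_add M.scale_right_distrib)
  have scl: "\<phi> x (scale c u) = \<phi> (scale c x) u" for x c u
    by (simp add: \<phi>_def generator_pmap_scale d_scale scale_mult)
  have square: "\<phi> x (u * u) = \<phi> (2 * x * u) u" for x u
    by (simp add: \<phi>_def generator_pmap_square d_mult M.scale_left_distrib[symmetric] algebra_simps mult_2)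
  have cancel: "b = c" if "?op a b = ?op a c" for a b c
    using that by (cases a; cases b; cases c) auto
  have "\<exists>\<Phi>. (\<forall>X Y. \<Phi> (X + Y) = ?op (\<Phi> X) (\<Phi> Y)) \<and> (\<forall>x u. \<Phi> (smul x (d u)) = \<phi> x u)"
    by (rule universal_additive_map[OF monoid zero add_left add_right scl
          polarised_product_rule[OF R.comm_algebra_axioms monoid odd_prime_two_neq_0[OF p] cancel add_left add_right scl square]])
  then obtain \<Phi> where \<Phi>_add: "\<And>X Y. \<Phi> (X + Y) = ?op (\<Phi> X) (\<Phi> Y)"
    and \<Phi>_gen: "\<And>x u. \<Phi> (smul x (d u)) = \<phi> x u" by blast
  have fst: "fst (\<Phi> X) = X" for X
    by (induction X rule: kaehler_induct) (simp_all add: \<Phi>_gen \<Phi>_add \<phi>_def case_prod_unfold)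
  show ?thesis
    by (rule exI[of _ "\<lambda>X. snd (\<Phi> X)"]) (simp add: \<Phi>_gen \<Phi>_add \<phi>_def case_prod_unfold fst)
qed

lemma brk_d_power: "(brk (d u) ^^ p) W = brk (d (pmap u)) W"
proof (induction W rule: kaehler_induct)
  case (generator y v)
  interpret D: module_derivation smul "anch (d u)" "brk (d u)"
    by (rule LR.anchor_module_derivation)
  have "(brk (d u) ^^ n) (d v) = d ((poisson u ^^ n) v)" for n
    by (induction n) (simp_all add: brk_d_d)
  then show ?case
    by (simp add: D.prime_power_product_rule[OF p(1) char_A] anch_d R.ad_pmap brk_smul brk_d_d)
next
  case (add X Y)
  have "(brk (d u) ^^ n) (X + Y) = (brk (d u) ^^ n) X + (brk (d u) ^^ n) Y" for n
    by (induction n) (simp_all add: brk_add_right)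
  then show ?case by (simp add: add brk_add_right)
qed

text \<open>
  Each axiom is additive in \<open>X\<close> up to terms in \<open>\<Lambda>\<close>, for which \<open>jacobson_Lambda_smult\<close> and
  \<open>rho_power_prime_add\<close> account. On \<open>x du\<close> the axioms are instances of Hochschild's formula.
\<close>

lemma restricted_structure:
  assumes P_add: "\<And>X Y. P (X + Y) = P X + P Y + \<Lambda> X Y"
    and P_gen: "\<And>x u. P (smul x (d u)) = generator_pmap x u"
  shows "restricted_lie_rinehart_algebra p scale smul brk anch P"
proof -
  have P_smul: "P (smul a X) = smul (a ^ p) (P X) + N a X" for a X
  proof (induction X rule: kaehler_induct)
    case (generator x u)
    show ?case
      using P_gen[of "a * x" u]
      by (simp add: P_gen generator_pmap_def LR.hochschild_term_mult[OF p(1,2)] power_mult_distrib M.scale_right_distrib)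
  next
    case (add X Y)
    then show ?case
      by (simp add: M.scale_right_distrib P_add LR.jacobson_Lambda_smult[OF p])
  qed
  have ad: "(brk X ^^ p) W = brk (P X) W" for X W
  proof (induction X rule: kaehler_induct)
    case (generator x u)
    show ?case
      by (simp only: LR.ad_smult_hochschild[OF p] P_gen generator_pmap_def brk_add_left)
         (simp add: LR.bracket_smult_left LR.anchor_power_prime[OF p(1,2)] brk_d_power)
  next
    case (add X Y)
    interpret Ad: lie_representation "restrict_scalars scale smul" brk "restrict_scalars scale smul" brk
      by (rule LR.adjoint_representation)
    show ?case
      by (simp only: Ad.rho_power_prime_add[OF p] P_add) (simp only: add brk_add_left)
  qed
  have anchor: "anch (P X) b = (anch X ^^ p) b" for X b
  proof (induction X rule: kaehler_induct)
    case (generator x u)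
    show ?case
      by (simp only: LR.anchor_smult_hochschild[OF p(1,2)] P_gen generator_pmap_def anch_add)
         (simp add: anch_smul anch_d R.ad_pmap)
  next
    case (add X Y)
    then show ?case
      by (simp only: LR.rep.rho_power_prime_add[OF p] P_add) (simp only: add anch_add)
  qed
  show ?thesis
  proof
    show "P (smul (scale c 1) X) = smul (scale (c ^ p) 1) (P X)" for c X
    proof -
      have "N (scale c 1) X = 0" by (rule N_eq_0) (rule anch_const)
      moreover have "scale c 1 ^ n = scale (c ^ n) 1" for n
        by (induction n) (simp_all add: scale_mult mult.commute)
      ultimately show ?thesis by (simp add: P_smul)
    qed
  qed (simp_all add: ad anchor P_add P_smul[unfolded LR.hochschild_term_def])
qed

end

theorem theorem0p5:
  fixes p :: nat
    and scale :: "'k::field \<Rightarrow> 'a::comm_ring_1 \<Rightarrow> 'a"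
    and poisson :: "'a \<Rightarrow> 'a \<Rightarrow> 'a"
    and pmap :: "'a \<Rightarrow> 'a"
    and smul :: "'a \<Rightarrow> 'o::ab_group_add \<Rightarrow> 'o"
    and d :: "'a \<Rightarrow> 'o"
  assumes "CHAR('k) = p" and "p \<ge> 3"
    and "restricted_poisson_algebra p scale poisson pmap"
    and "kaehler_differentials scale smul d"
    and "free_module smul"
  shows "\<exists>P. restricted_lie_rinehart_algebra p scale smul
        (kaehler_bracket smul d poisson) (kaehler_anchor smul d poisson) P \<and>
      (\<forall>Q. restricted_lie_algebra p (restrict_scalars scale smul) (kaehler_bracket smul d poisson) Q \<and>
         (\<forall>x u. Q (smul x (d u)) =
            smul (x ^ p) (d (pmap u))
            + smul ((kaehler_anchor smul d poisson (smul x (d u)) ^^ (p - 1)) x) (d u))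
         \<longleftrightarrow> Q = P)"
proof -
  have prime: "prime p" using assms(1,2) prime_CHAR_semidom[where 'a = 'k] by auto
  have char: "of_nat p = (0::'k)" using assms(1) of_nat_CHAR[where 'a = 'k] by simp
  have odd: "odd p" using prime assms(2) prime_odd_nat[of p] by auto
  have "restricted_poisson_kaehler p scale poisson pmap smul d"
  proof -
    interpret R: restricted_poisson_algebra p scale poisson pmap by fact
    interpret K: kaehler_differentials scale smul d by fact
    show ?thesis by unfold_locales (fact prime char odd)+
  qed
  then interpret restricted_poisson_kaehler p scale poisson pmap smul d .
  have pmap_formula: "generator_pmap x u = smul (x ^ p) (d (pmap u)) + smul ((anch (smul x (d u)) ^^ (p - 1)) x) (d u)" for x u
    by (simp only: generator_pmap_def LR.hochschild_term_def)
  obtain P where P_add: "\<And>X Y. P (X + Y) = P X + P Y + \<Lambda> X Y"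
    and P_gen: "\<And>x u. P (smul x (d u)) = generator_pmap x u"
    using ex_pmap by blast
  interpret P: restricted_lie_rinehart_algebra p scale smul brk anch P
    by (rule restricted_structure[OF P_add P_gen])
  show ?thesis
  proof (intro exI[of _ P] conjI allI iffI)
    show "restricted_lie_rinehart_algebra p scale smul brk anch P" by unfold_locales
  next
    fix Q assume Q: "restricted_lie_algebra p (restrict_scalars scale smul) brk Q \<and>
      (\<forall>x u. Q (smul x (d u)) = smul (x ^ p) (d (pmap u)) + smul ((anch (smul x (d u)) ^^ (p - 1)) x) (d u))"
    then interpret Q: restricted_lie_algebra p "restrict_scalars scale smul" brk Q by blast
    have "Q X = P X" for X
    proof (induction X rule: kaehler_induct)
      case (generator x u)
      then show ?case using Q by (simp only: P_gen pmap_formula)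
    next
      case (add X Y)
      then show ?case by (simp only: Q.pmap_add P_add)
    qed
    then show "Q = P" by blast
  next
    fix Q assume "Q = P"
    then show "restricted_lie_algebra p (restrict_scalars scale smul) brk Q"
      by simp unfold_locales
  next
    fix Q x u assume "Q = P"
    then show "Q (smul x (d u)) = smul (x ^ p) (d (pmap u)) + smul ((anch (smul x (d u)) ^^ (p - 1)) x) (d u)"
      by (simp only: P_gen pmap_formula)
  qed
qed

end
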